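(* Let $n=4m$ with $m\in\mathbb{N}$, $n=2r$, $a>0$, and let $K$ be the two-periodic Kasteleyn matrix with parameters $(a,1)$ on the Aztec diamond of size $n$ (see context). Let $G(a,1,\mathtt{w},\mathtt{b})=\sum_{x\in\mathtt{W}}\sum_{y\in\mathtt{B}}K^{-1}(x,y)w_1^{x_1}w_2^{x_2}b_1^{y_1}b_2^{y_2}$. Then $$G(a,1,\mathtt{w},\mathtt{b})=\frac{d(\mathtt{w},\mathtt{b})}{c_\partial(w_1,w_2)}+\sum_{\epsilon,\delta\in\{0,1\}}\sum_{k,l\in\{0,2n\}}\sum_{(x_1,k)\in\mathtt{W}_\epsilon}\sum_{(l,y_2)\in\mathtt{B}_\delta}\frac{s_{\epsilon,k}(w_1,w_2)\,s_{\delta,l}(b_2,b_1)\,K^{-1}((x_1,k),(l,y_2))}{c_\partial(w_1,w_2)\,c_\partial(b_1,b_2)}\,w_1^{x_1}b_2^{y_2},$$ and moreover, for all admissible $x_1$ (odd, $1\le x_1\le 2n-1$) and $y_2$ (odd, $1\le y_2\le 2n-1$), $$\begin{aligned}K^{-1}((x_1,0),(0,y_2))&=L\big(a,1,\tfrac{x_1-1}{2},\tfrac{y_2-1}{2}\big),\\ K^{-1}((x_1,0),(2n,y_2))&=\mathrm{i}^{2n-1-x_1+y_2}L\big(1,a,n-\tfrac{x_1+1}{2},\tfrac{y_2-1}{2}\big),\\ K^{-1}((x_1,2n),(0,y_2))&=\mathrm{i}^{2n-1+x_1-y_2}L\big(1,a,\tfrac{x_1-1}{2},n-\tfrac{y_2+1}{2}\big),\\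 K^{-1}((x_1,2n),(2n,y_2))&=L\big(a,1,n-\tfrac{x_1+1}{2},n-\tfrac{y_2+1}{2}\big).\end{aligned}$$
   Context: $\mathrm{i}=\sqrt{-1}$. Aztec diamond of size $n$: $\mathtt{W}=\{(x_1,x_2): x_1\text{ odd},\ x_2\text{ even},\ 1\le x_1\le 2n-1,\ 0\le x_2\le 2n\}$, $\mathtt{B}=\{(x_1,x_2): x_1\text{ even},\ x_2\text{ odd},\ 0\le x_1\le 2n,\ 1\le x_2\le 2n-1\}$, $e_1=(1,1)$, $e_2=(-1,1)$. For $\epsilon\in\{0,1\}$: $\mathtt{W}_\epsilon=\{(x_1,x_2)\in\mathtt{W}:(x_1+x_2)\bmod 4=2\epsilon+1\}$, $\mathtt{B}_\epsilon=\{(x_1,x_2)\in\mathtt{B}:(x_1+x_2)\bmod4=2\epsilon+1\}$. For parameters $\alpha,\beta>0$, the two-periodic Kasteleyn matrix $K_{\alpha,\beta}$ (rows $\mathtt{B}$, columns $\mathtt{W}$) is: for $x\in\mathtt{B}_\epsilon$, $K_{\alpha,\beta}(x,x+e_1)=\alpha(1-\epsilon)+\beta\epsilon$, $K_{\alpha,\beta}(x,x+e_2)=(\alpha\epsilon+\beta(1-\epsilon))\mathrm{i}$, $K_{\alpha,\beta}(x,x-e_1)=\alpha\epsilon+\beta(1-\epsilon)$, $K_{\alpha,\beta}(x,x-e_2)=(\alpha(1-\epsilon)+\beta\epsilon)\mathrm{i}$ (when the neighbour lies in $\mathtt{W}$), and $0$ otherwise. $K=K_{a,1}$. $L(\alpha,\beta,i,j):=K_{\alpha,\beta}^{-1}((2i+1,0),(0,2j+1))$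 on the Aztec diamond of size $n$. $f_k(t)=(1-t^k)/(1-t)$. $c_\partial(r_1,r_2)=2(1+a^2)+a(r_1^2+r_1^{-2})(r_2^2+r_2^{-2})$; $s_{\epsilon,0}(r_1,r_2)=-a(r_1^{-2}r_2^{-2}+r_1^2r_2^{-2})-a\mathrm{i}r_1^2+a\mathrm{i}r_1^{-2}-2a^{2\epsilon}$; $s_{\epsilon,2n}(r_1,r_2)=r_2^{2n}\big(-a(r_1^2r_2^2+r_1^{-2}r_2^2)+a\mathrm{i}r_1^2-a\mathrm{i}r_1^{-2}-2a^{2(1-\epsilon)}\big)$. $d_{\mathrm{sides}}(\mathtt{w},\mathtt{b})=s_{0,0}(w_1,w_2)\big(a(b_1^2-\mathrm{i})w_1b_2+w_1b_2^{-1}(1-\mathrm{i}b_1^2)\big)+s_{1,0}(w_1,w_2)\big((b_1^2-\mathrm{i})w_1^3b_1^2b_2+aw_1^3b_1^2b_2^{-1}(1-\mathrm{i}b_1^2)\big)+s_{0,2n}(w_1,w_2)\big((1-\mathrm{i}b_1^2)w_1b_2^{2n-1}+aw_1b_2^{2n+1}(b_1^2-\mathrm{i})\big)+s_{1,2n}(w_1,w_2)\big(a(1-\mathrm{i}b_1^2)w_1^3b_1^2b_2^{2n-1}+w_1^3b_1^2b_2^{2n+1}(b_1^2-\mathrm{i})\big)$. $d(\mathtt{w},\mathtt{b})=f_r(w_2^4b_2^4)f_r(w_1^4b_1^4)\,b_2w_1\big(a+w_1^2b_1^2+w_2^2b_2^2(1+aw_1^2b_1^2)\big)\big(w_2^2+b_1^2-\mathrm{i}(1+w_2^2b_1^2)\big)+\big((1-\mathrm{i}w_2^2)w_1^{-1}b_2(1+aw_2^2b_2^2)+(w_2^2-\mathrm{i})w_1^{2n+1}b_1^{2n}b_2(a+w_2^2b_2^2)\big)f_r(w_2^4b_2^4)-\frac{d_{\mathrm{sides}}(\mathtt{w},\mathtt{b})}{c_\partial(b_1,b_2)}f_r(w_1^4b_1^4)$.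 *)

theory Defs
  imports Complex_Main
begin

definition Wv :: "nat \<Rightarrow> (int \<times> int) set" where
  "Wv n = {(x1, x2). odd x1 \<and> even x2 \<and> 1 \<le> x1 \<and> x1 \<le> 2 * int n - 1 \<and> 0 \<le> x2 \<and> x2 \<le> 2 * int n}"

definition Bv :: "nat \<Rightarrow> (int \<times> int) set" where
  "Bv n = {(x1, x2). even x1 \<and> odd x2 \<and> 0 \<le> x1 \<and> x1 \<le> 2 * int n \<and> 1 \<le> x2 \<and> x2 \<le> 2 * int n - 1}"

definition Weps :: "nat \<Rightarrow> nat \<Rightarrow> (int \<times> int) set" where
  "Weps n \<epsilon> = {x \<in> Wv n. (fst x + snd x) mod 4 = 2 * int \<epsilon> + 1}"

definition Beps :: "nat \<Rightarrow> nat \<Rightarrow> (int \<times> int) set" where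
  "Beps n \<epsilon> = {x \<in> Bv n. (fst x + snd x) mod 4 = 2 * int \<epsilon> + 1}"

definition Kast :: "nat \<Rightarrow> real \<Rightarrow> real \<Rightarrow> int \<times> int \<Rightarrow> int \<times> int \<Rightarrow> complex" where
  "Kast n \<alpha> \<beta> x y =
    (if x \<in> Bv n \<and> y \<in> Wv n then
       (let e = (if (fst x + snd x) mod 4 = 1 then 0 else 1 :: real) in
        if y = (fst x + 1, snd x + 1) then complex_of_real (\<alpha> * (1 - e) + \<beta> * e)
        else if y = (fst x - 1, snd x + 1) then complex_of_real (\<alpha> * e + \<beta> * (1 - e)) * \<i>
        else if y = (fst x - 1, snd x - 1) then complex_of_real (\<alpha> * e + \<beta> * (1 - e))
        else if y = (fst x + 1, snd x - 1) then complex_of_real (\<alpha> * (1 - e) + \<beta> * e) * \<i>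
        else 0)
     else 0)"

definition Kinv :: "nat \<Rightarrow> real \<Rightarrow> real \<Rightarrow> int \<times> int \<Rightarrow> int \<times> int \<Rightarrow> complex" where
  "Kinv n \<alpha> \<beta> = (THE F.
      (\<forall>x y. (x \<notin> Wv n \<or> y \<notin> Bv n) \<longrightarrow> F x y = 0) \<and>
      (\<forall>b\<in>Bv n. \<forall>b'\<in>Bv n. (\<Sum>w\<in>Wv n. Kast n \<alpha> \<beta> b w * F w b') = (if b = b' then 1 else 0)) \<and>
      (\<forall>w\<in>Wv n. \<forall>w'\<in>Wv n. (\<Sum>b\<in>Bv n. F w b * Kast n \<alpha> \<beta> b w') = (if w = w' then 1 else 0)))"

definition L :: "nat \<Rightarrow> real \<Rightarrow> real \<Rightarrow> int \<Rightarrow> int \<Rightarrow> complex" where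
  "L n \<alpha> \<beta> i j = Kinv n \<alpha> \<beta> (2 * i + 1, 0) (0, 2 * j + 1)"

definition Gf :: "nat \<Rightarrow> real \<Rightarrow> complex \<Rightarrow> complex \<Rightarrow> complex \<Rightarrow> complex \<Rightarrow> complex" where
  "Gf n a w1 w2 b1 b2 = (\<Sum>x\<in>Wv n. \<Sum>y\<in>Bv n.
      Kinv n a 1 x y * w1 powi (fst x) * w2 powi (snd x) * b1 powi (fst y) * b2 powi (snd y))"

text \<open>f_k(t) = (1 - t^k)/(1 - t), taken as the polynomial 1 + t + ... + t^(k-1).\<close>
definition fk :: "nat \<Rightarrow> complex \<Rightarrow> complex" where
  "fk k t = (\<Sum>j<k. t ^ j)"

definition cdel :: "real \<Rightarrow> complex \<Rightarrow> complex \<Rightarrow> complex" where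
  "cdel a r1 r2 = (let A = complex_of_real a in
     2 * (1 + A\<^sup>2) + A * (r1\<^sup>2 + inverse (r1\<^sup>2)) * (r2\<^sup>2 + inverse (r2\<^sup>2)))"

definition s0 :: "real \<Rightarrow> nat \<Rightarrow> complex \<Rightarrow> complex \<Rightarrow> complex" where
  "s0 a \<epsilon> r1 r2 = (let A = complex_of_real a in
     - A * (inverse (r1\<^sup>2) * inverse (r2\<^sup>2) + r1\<^sup>2 * inverse (r2\<^sup>2))
     - A * \<i> * r1\<^sup>2 + A * \<i> * inverse (r1\<^sup>2) - 2 * A ^ (2 * \<epsilon>))"

definition s2n :: "real \<Rightarrow> nat \<Rightarrow> nat \<Rightarrow> complex \<Rightarrow> complex \<Rightarrow> complex" where
  "s2n a n \<epsilon> r1 r2 = (let A = complex_of_real a in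
     r2 ^ (2 * n) * (- A * (r1\<^sup>2 * r2\<^sup>2 + inverse (r1\<^sup>2) * r2\<^sup>2)
     + A * \<i> * r1\<^sup>2 - A * \<i> * inverse (r1\<^sup>2) - 2 * A ^ (2 * (1 - \<epsilon>))))"

definition sek :: "real \<Rightarrow> nat \<Rightarrow> nat \<Rightarrow> int \<Rightarrow> complex \<Rightarrow> complex \<Rightarrow> complex" where
  "sek a n \<epsilon> k r1 r2 = (if k = 0 then s0 a \<epsilon> r1 r2 else if k = 2 * int n then s2n a n \<epsilon> r1 r2 else 0)"

definition dsides :: "real \<Rightarrow> nat \<Rightarrow> complex \<Rightarrow> complex \<Rightarrow> complex \<Rightarrow> complex \<Rightarrow> complex" where
  "dsides a n w1 w2 b1 b2 = (let A = complex_of_real a in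
       s0 a 0 w1 w2 * (A * (b1\<^sup>2 - \<i>) * w1 * b2 + w1 * inverse b2 * (1 - \<i> * b1\<^sup>2))
     + s0 a 1 w1 w2 * ((b1\<^sup>2 - \<i>) * w1 ^ 3 * b1\<^sup>2 * b2 + A * w1 ^ 3 * b1\<^sup>2 * inverse b2 * (1 - \<i> * b1\<^sup>2))
     + s2n a n 0 w1 w2 * ((1 - \<i> * b1\<^sup>2) * w1 * b2 powi (2 * int n - 1) + A * w1 * b2 ^ (2 * n + 1) * (b1\<^sup>2 - \<i>))
     + s2n a n 1 w1 w2 * (A * (1 - \<i> * b1\<^sup>2) * w1 ^ 3 * b1\<^sup>2 * b2 powi (2 * int n - 1)
                          + w1 ^ 3 * b1\<^sup>2 * b2 ^ (2 * n + 1) * (b1\<^sup>2 - \<i>)))"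

definition dfun :: "real \<Rightarrow> nat \<Rightarrow> complex \<Rightarrow> complex \<Rightarrow> complex \<Rightarrow> complex \<Rightarrow> complex" where
  "dfun a n w1 w2 b1 b2 = (let A = complex_of_real a; r = n div 2 in
       fk r (w2 ^ 4 * b2 ^ 4) * fk r (w1 ^ 4 * b1 ^ 4) * b2 * w1
         * (A + w1\<^sup>2 * b1\<^sup>2 + w2\<^sup>2 * b2\<^sup>2 * (1 + A * w1\<^sup>2 * b1\<^sup>2))
         * (w2\<^sup>2 + b1\<^sup>2 - \<i> * (1 + w2\<^sup>2 * b1\<^sup>2))
     + ((1 - \<i> * w2\<^sup>2) * inverse w1 * b2 * (1 + A * w2\<^sup>2 * b2\<^sup>2)
        + (w2\<^sup>2 - \<i>) * w1 ^ (2 * n + 1) * b1 ^ (2 * n) * b2 * (A + w2\<^sup>2 * b2\<^sup>2)) * fk r (w2 ^ 4 * b2 ^ 4)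
     - dsides a n w1 w2 b1 b2 / cdel a b1 b2 * fk r (w1 ^ 4 * b1 ^ 4))"

end

theory Submission
  imports Defs
begin

text \<open>
  The odd-odd faces split the edges of the Aztec diamond into \<open>n\<^sup>2\<close> disjoint 4-cycles. Inverting the
  \<open>2 \<times> 2\<close> block of each of them (urban renewal) turns the Kasteleyn system of size \<open>n\<close>, with arbitrary
  positive weights, into one of size \<open>n - 1\<close>; hence the Kasteleyn matrix is invertible.

  On generating functions the two-periodic Kasteleyn matrix of the whole plane acts as a \<open>2 \<times> 2\<close> matrix
  of Laurent polynomials whose determinant is \<open>- cdel\<close>. Multiplying \<open>K K\<inverse> = 1\<close> and \<open>K\<inverse> K = 1\<close> by the
  adjugate expresses \<open>cdel\<close> times the generating function of a column or a row of \<open>K\<inverse>\<close> through its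
  entries on the sides of the diamond. The factors \<open>s\<close> are the terms of \<open>cdel\<close> that are cut off there.
  Using the first relation in \<open>w\<close> and then the second in \<open>b\<close> gives the formula, with geometric sums
  for the diagonal terms. The relations between the sides come from a rotation and a reflection of
  the diamond; the latter exchanges the two parameters up to a gauge factor.
\<close>

section \<open>Invertibility of the Kasteleyn matrix\<close>

text \<open>
  In the induction step, \<open>v\<close> is the contribution of the face to the right of a vertex of \<open>Bv\<close> to its
  equation, so that the face to the left contributes \<open>g - v\<close>. Solving for the two values of \<open>F\<close> at a
  face gives \<open>top\<close> and \<open>bot\<close>, and the requirement that neighbouring faces agree on their common vertex
  is the smaller system, shifted by \<open>(1, 1)\<close>.
\<close>

lemma weighted_system_solvable:
  fixes p q r s :: "int \<Rightarrow> int \<Rightarrow> real" and g :: "int \<Rightarrow> int \<Rightarrow> complex"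
  assumes "\<And>i j. p i j > 0" "\<And>i j. q i j > 0" "\<And>i j. r i j > 0" "\<And>i j. s i j > 0"
  shows "\<exists>F :: int \<Rightarrow> int \<Rightarrow> complex. (\<forall>i j. (i, j) \<notin> Wv n \<longrightarrow> F i j = 0) \<and>
             (\<forall>i j. (i, j) \<in> Bv n \<longrightarrow>
               p i j * F (i + 1) (j + 1) + \<i> * q i j * F (i + 1) (j - 1)
               + \<i> * r i j * F (i - 1) (j + 1) + s i j * F (i - 1) (j - 1) = g i j)"
  using assms
proof (induction n arbitrary: p q r s g)
  case 0
  show ?case by (rule exI[of _ "\<lambda>_ _. 0"]) (auto simp: Bv_def)
next
  case (Suc n)
  \<comment> \<open>The determinant of the face centred at \<open>(i, j)\<close>. The two factors
    \<open>\<i>\<close> turn the minus sign of a determinant into a plus, so that positive weights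
    make it nonzero.\<close>
  define D where "D i j = p (i - 1) j * s (i + 1) j + q (i - 1) j * r (i + 1) j" for i j
  have D_pos: "D i j > 0" for i j
    unfolding D_def using Suc.prems by (simp add: add_pos_pos)
  \<comment> \<open>The new weights are the coefficients of \<open>v\<close> at the four corners in
    the condition \<open>top (i + 1) (j + 1) = bot (i + 1) (j + 3)\<close>, by which the faces below
    and above a common vertex agree. They are again positive, as the induction hypothesis
    demands.\<close>
  define p' where "p' i j = p i (j + 2) / D (i + 1) (j + 2)" for i j
  define q' where "q' i j = q i j / D (i + 1) j" for i j
  define r' where "r' i j = r (i + 2) (j + 2) / D (i + 1) (j + 2)" for i j
  define s' where "s' i j = s (i + 2) j / D (i + 1) j" for i j
  \<comment> \<open>For \<open>i = 0\<close> the two left corners lie on the side of the diamond,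
    where \<open>v\<close> is known; their terms move to the right-hand side.\<close>
  define g' where "g' i j = \<i> * q' i j * g (i + 2) j + p' i j * g (i + 2) (j + 2)
      - (if i = 0 then \<i> * r' i j * g 0 (j + 2) + s' i j * g 0 j else 0)" for i j
  obtain V :: "int \<Rightarrow> int \<Rightarrow> complex" where V0: "\<And>i j. (i, j) \<notin> Wv n \<Longrightarrow> V i j = 0"
    and V: "\<And>i j. (i, j) \<in> Bv n \<Longrightarrow>
               p' i j * V (i + 1) (j + 1) + \<i> * q' i j * V (i + 1) (j - 1)
               + \<i> * r' i j * V (i - 1) (j + 1) + s' i j * V (i - 1) (j - 1) = g' i j"
    using Suc.IH[of p' q' r' s' g'] Suc.prems D_pos
    by (auto simp: p'_def q'_def r'_def s'_def)
  \<comment> \<open>No face lies to the left of the side \<open>i = 0\<close>, so the face to its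
    right has to account for all of \<open>g 0 j\<close>. On the opposite side \<open>v\<close>
    vanishes because \<open>V\<close> vanishes outside \<open>Wv n\<close>, and no face lies to the
    right of it.\<close>
  define v where "v i j = (if i = 0 then g 0 j else V (i - 1) (j - 1))" for i j
  define top where "top i j = (s (i + 1) j * v (i - 1) j - \<i> * q (i - 1) j * (g (i + 1) j - v (i + 1) j)) / D i j" for i j
  define bot where "bot i j = (- \<i> * r (i + 1) j * v (i - 1) j + p (i - 1) j * (g (i + 1) j - v (i + 1) j)) / D i j" for i j
  \<comment> \<open>A vertex is read off as the top of the face below it, except on the line
    \<open>j = 0\<close>, where only the face above exists.\<close>
  define F where "F i j = (if (i, j) \<in> Wv (Suc n) then if j = 0 then bot i (j + 1) else top i (j - 1) else 0)" for i j
  have Dc: "complex_of_real (D i j) \<noteq> 0" for i j using D_pos[of i j] by simp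
  have left: "p (i - 1) j * top i j + \<i> * q (i - 1) j * bot i j = v (i - 1) j" for i j
  proof -
    have "p (i - 1) j * top i j + \<i> * q (i - 1) j * bot i j = (D i j * v (i - 1) j) / D i j"
      unfolding top_def bot_def D_def by (simp add: algebra_simps add_divide_distrib diff_divide_distrib)
    then show ?thesis using Dc by simp
  qed
  have right: "\<i> * r (i + 1) j * top i j + s (i + 1) j * bot i j = g (i + 1) j - v (i + 1) j" for i j
  proof -
    have "\<i> * r (i + 1) j * top i j + s (i + 1) j * bot i j = (D i j * (g (i + 1) j - v (i + 1) j)) / D i j"
      unfolding top_def bot_def D_def by (simp add: algebra_simps add_divide_distrib diff_divide_distrib)
    then show ?thesis using Dc by simp
  qed
  have F_top: "F i (j + 1) = top i j" if "odd i" "odd j" "1 \<le> i" "i \<le> 2 * int n + 1" "1 \<le> j" "j \<le> 2 * int n + 1" for i j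
    using that by (auto simp: F_def Wv_def)
  have glue: "top i (j - 1) = bot i (j + 1)"
    if "odd i" "even j" "1 \<le> i" "i \<le> 2 * int n + 1" "2 \<le> j" "j \<le> 2 * int n" for i j
  proof -
    have "(i - 1, j - 1) \<in> Bv n" using that by (auto simp: Bv_def)
    note e = V[OF this]
    have v1: "V i (j - 2) = v (i + 1) (j - 1)" "V i j = v (i + 1) (j + 1)"
      using that by (auto simp: v_def)
    have "(- 1, k) \<notin> Wv n" for k by (auto simp: Wv_def)
    then have v2: "V (i - 2) k = (if i = 1 then 0 else v (i - 1) (k + 1))" for k
      using V0 by (auto simp: v_def)
    have v3: "i = 1 \<Longrightarrow> v 0 k = g 0 k" for k by (simp add: v_def)
    show ?thesis
      using e v3 unfolding g'_def top_def bot_def p'_def q'_def r'_def s'_def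
      by (simp add: v1 v2 algebra_simps add_divide_distrib diff_divide_distrib split: if_splits)
  qed
  have F_bot: "F i (j - 1) = bot i j" if "odd i" "odd j" "1 \<le> i" "i \<le> 2 * int n + 1" "1 \<le> j" "j \<le> 2 * int n + 1" for i j
  proof (cases "j = 1")
    case True
    then show ?thesis using that by (auto simp: F_def Wv_def)
  next
    case False
    then have "j \<ge> 2" using that by simp
    moreover have "j \<noteq> 2" using that by auto
    ultimately have "F i (j - 1) = top i (j - 1 - 1)" using that by (auto simp: F_def Wv_def)
    also have "\<dots> = bot i (j - 1 + 1)"
      by (rule glue) (use that \<open>j \<ge> 2\<close> \<open>j \<noteq> 2\<close> in \<open>auto\<close>)
    finally show ?thesis by simp
  qed
  show ?case
  proof (intro exI[of _ F] conjI allI impI)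
    fix i j assume "(i, j) \<notin> Wv (Suc n)"
    then show "F i j = 0" by (simp add: F_def)
  next
    fix i j assume b: "(i, j) \<in> Bv (Suc n)"
    have 1: "p i j * F (i + 1) (j + 1) + \<i> * q i j * F (i + 1) (j - 1) = v i j"
    proof (cases "i = 2 * int n + 2")
      case True
      then have "F (i + 1) k = 0" for k by (auto simp: F_def Wv_def)
      moreover have "v i j = 0" using True V0[of "i - 1" "j - 1"] by (auto simp: v_def Wv_def)
      ultimately show ?thesis by simp
    next
      case False
      then have "F (i + 1) (j + 1) = top (i + 1) j" "F (i + 1) (j - 1) = bot (i + 1) j"
        using b by (auto simp: Bv_def intro!: F_top F_bot)
      then show ?thesis using left[of "i + 1" j] by simp
    qed
    have 2: "\<i> * r i j * F (i - 1) (j + 1) + s i j * F (i - 1) (j - 1) = g i j - v i j"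
    proof (cases "i = 0")
      case True
      then have "F (i - 1) k = 0" for k by (auto simp: F_def Wv_def)
      then show ?thesis using True by (simp add: v_def)
    next
      case False
      have "i \<noteq> 1" using b by (auto simp: Bv_def)
      then have "F (i - 1) (j + 1) = top (i - 1) j" "F (i - 1) (j - 1) = bot (i - 1) j"
        using b False by (auto simp: Bv_def intro!: F_top F_bot)
      then show ?thesis using right[of "i - 1" j] by simp
    qed
    show "p i j * F (i + 1) (j + 1) + \<i> * q i j * F (i + 1) (j - 1)
               + \<i> * r i j * F (i - 1) (j + 1) + s i j * F (i - 1) (j - 1) = g i j"
      using 1 2 by (simp add: algebra_simps)
  qed
qed

section \<open>The Kasteleyn equations written out over the four neighbours of a vertex\<close>

lemma finite_Wv [simp]: "finite (Wv n)"
  by (rule finite_subset[of _ "{1..2 * int n} \<times> {0..2 * int n}"]) (auto simp: Wv_def)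

lemma finite_Bv [simp]: "finite (Bv n)"
  by (rule finite_subset[of _ "{0..2 * int n} \<times> {1..2 * int n}"]) (auto simp: Bv_def)

text \<open>The edges from a vertex of \<open>Bv\<close> to the right have weight
  \<open>wt \<alpha> \<beta>\<close> and those to the left have weight
  \<open>wt \<beta> \<alpha>\<close>, up to the factors \<open>\<i>\<close>. Changing the class of
  the vertex amounts to exchanging the two parameters.\<close>

definition wt :: "real \<Rightarrow> real \<Rightarrow> int \<Rightarrow> int \<Rightarrow> real" where
  "wt \<alpha> \<beta> i j = (if (i + j) mod 4 = 1 then \<alpha> else \<beta>)"

lemma Kast_eq_wt:
  "Kast n \<alpha> \<beta> (i, j) (k, l) =
     (if (i, j) \<in> Bv n \<and> (k, l) \<in> Wv n then
        if k = i + 1 \<and> l = j + 1 then wt \<alpha> \<beta> i j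
        else if k = i - 1 \<and> l = j + 1 then \<i> * wt \<beta> \<alpha> i j
        else if k = i - 1 \<and> l = j - 1 then wt \<beta> \<alpha> i j
        else if k = i + 1 \<and> l = j - 1 then \<i> * wt \<alpha> \<beta> i j
        else 0
      else 0)"
  by (simp add: Kast_def wt_def Let_def)

text \<open>As \<open>F\<close> vanishes outside \<open>Wv n\<close>, neighbours beyond the boundary
  contribute zero, and one formula serves inner and boundary vertices alike.\<close>

lemma sum_Kast_row:
  fixes F :: "int \<times> int \<Rightarrow> complex"
  assumes b: "(i, j) \<in> Bv n" and F: "\<And>x. x \<notin> Wv n \<Longrightarrow> F x = 0"
  shows "(\<Sum>w\<in>Wv n. Kast n \<alpha> \<beta> (i, j) w * F w) =
           wt \<alpha> \<beta> i j * F (i + 1, j + 1) + \<i> * wt \<alpha> \<beta> i j * F (i + 1, j - 1)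
           + \<i> * wt \<beta> \<alpha> i j * F (i - 1, j + 1) + wt \<beta> \<alpha> i j * F (i - 1, j - 1)"
proof -
  let ?N = "{(i + 1, j + 1), (i + 1, j - 1), (i - 1, j + 1), (i - 1, j - 1)}"
  define H where "H w = (if w = (i + 1, j + 1) then wt \<alpha> \<beta> i j
        else if w = (i - 1, j + 1) then \<i> * wt \<beta> \<alpha> i j
        else if w = (i - 1, j - 1) then wt \<beta> \<alpha> i j
        else if w = (i + 1, j - 1) then \<i> * wt \<alpha> \<beta> i j
        else 0)" for w
  have "(\<Sum>w\<in>Wv n. Kast n \<alpha> \<beta> (i, j) w * F w) = (\<Sum>w\<in>Wv n. H w * F w)"
  proof (rule sum.cong)
    fix w assume "w \<in> Wv n"
    then show "Kast n \<alpha> \<beta> (i, j) w * F w = H w * F w"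
      using b by (cases w) (simp only: H_def Kast_eq_wt prod.inject simp_thms if_True)
  qed simp
  also have "\<dots> = (\<Sum>w\<in>Wv n \<union> ?N. H w * F w)"
    by (rule sum.mono_neutral_left) (auto simp: F)
  also have "\<dots> = (\<Sum>w\<in>?N. H w * F w)"
    by (rule sum.mono_neutral_right) (auto simp: H_def)
  also have "\<dots> = wt \<alpha> \<beta> i j * F (i + 1, j + 1) + \<i> * wt \<alpha> \<beta> i j * F (i + 1, j - 1)
           + \<i> * wt \<beta> \<alpha> i j * F (i - 1, j + 1) + wt \<beta> \<alpha> i j * F (i - 1, j - 1)"
    by (simp add: H_def)
  finally show ?thesis .
qed

text \<open>The weights belong to the end of the edge in \<open>Bv\<close>: a right neighbour of
  \<open>(i, j)\<close> sees it on its left, which is why \<open>\<alpha>\<close> and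
  \<open>\<beta>\<close> trade places compared with \<open>sum_Kast_row\<close>.\<close>

lemma sum_Kast_col:
  fixes G :: "int \<times> int \<Rightarrow> complex"
  assumes w: "(i, j) \<in> Wv n" and G: "\<And>x. x \<notin> Bv n \<Longrightarrow> G x = 0"
  shows "(\<Sum>b\<in>Bv n. G b * Kast n \<alpha> \<beta> b (i, j)) =
           wt \<beta> \<alpha> (i + 1) (j + 1) * G (i + 1, j + 1) + \<i> * wt \<beta> \<alpha> (i + 1) (j - 1) * G (i + 1, j - 1)
           + \<i> * wt \<alpha> \<beta> (i - 1) (j + 1) * G (i - 1, j + 1) + wt \<alpha> \<beta> (i - 1) (j - 1) * G (i - 1, j - 1)"
proof -
  let ?N = "{(i + 1, j + 1), (i + 1, j - 1), (i - 1, j + 1), (i - 1, j - 1)}"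
  define H where "H b = (if b = (i + 1, j + 1) then wt \<beta> \<alpha> (i + 1) (j + 1)
        else if b = (i - 1, j + 1) then \<i> * wt \<alpha> \<beta> (i - 1) (j + 1)
        else if b = (i - 1, j - 1) then wt \<alpha> \<beta> (i - 1) (j - 1)
        else if b = (i + 1, j - 1) then \<i> * wt \<beta> \<alpha> (i + 1) (j - 1)
        else 0)" for b
  have "(\<Sum>b\<in>Bv n. G b * Kast n \<alpha> \<beta> b (i, j)) = (\<Sum>b\<in>Bv n. H b * G b)"
  proof (rule sum.cong)
    fix b assume "b \<in> Bv n"
    moreover obtain k l where b: "b = (k, l)" by fastforce
    moreover have "i = k + 1 \<longleftrightarrow> k = i - 1" "i = k - 1 \<longleftrightarrow> k = i + 1"
      "j = l + 1 \<longleftrightarrow> l = j - 1" "j = l - 1 \<longleftrightarrow> l = j + 1" by auto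
    ultimately have "Kast n \<alpha> \<beta> b (i, j) = H b"
      using w unfolding b H_def Kast_eq_wt by (simp only: prod.inject simp_thms if_True) (simp only: split: if_split, auto)
    then show "G b * Kast n \<alpha> \<beta> b (i, j) = H b * G b" by simp
  qed simp
  also have "\<dots> = (\<Sum>b\<in>Bv n \<union> ?N. H b * G b)"
    by (rule sum.mono_neutral_left) (auto simp: G)
  also have "\<dots> = (\<Sum>b\<in>?N. H b * G b)"
    by (rule sum.mono_neutral_right) (auto simp: H_def)
  also have "\<dots> = wt \<beta> \<alpha> (i + 1) (j + 1) * G (i + 1, j + 1) + \<i> * wt \<beta> \<alpha> (i + 1) (j - 1) * G (i + 1, j - 1)
           + \<i> * wt \<alpha> \<beta> (i - 1) (j + 1) * G (i - 1, j + 1) + wt \<alpha> \<beta> (i - 1) (j - 1) * G (i - 1, j - 1)"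
    by (simp add: H_def)
  finally show ?thesis .
qed

lemma wt_pos: "\<alpha> > 0 \<Longrightarrow> \<beta> > 0 \<Longrightarrow> wt \<alpha> \<beta> i j > 0"
  by (simp add: wt_def)

lemma swap_mem_Bv: "(j, i) \<in> Bv n \<longleftrightarrow> (i, j) \<in> Wv n"
  and swap_mem_Wv: "(j, i) \<in> Wv n \<longleftrightarrow> (i, j) \<in> Bv n"
  by (auto simp: Bv_def Wv_def)

lemma Kast_right_solvable:
  assumes "\<alpha> > 0" "\<beta> > 0"
  obtains F :: "int \<times> int \<Rightarrow> complex" where "\<And>x. x \<notin> Wv n \<Longrightarrow> F x = 0"
    and "\<And>b. b \<in> Bv n \<Longrightarrow> (\<Sum>w\<in>Wv n. Kast n \<alpha> \<beta> b w * F w) = g b"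
proof -
  obtain F :: "int \<Rightarrow> int \<Rightarrow> complex" where F0: "\<And>i j. (i, j) \<notin> Wv n \<Longrightarrow> F i j = 0"
    and F: "\<And>i j. (i, j) \<in> Bv n \<Longrightarrow>
      wt \<alpha> \<beta> i j * F (i + 1) (j + 1) + \<i> * wt \<alpha> \<beta> i j * F (i + 1) (j - 1)
      + \<i> * wt \<beta> \<alpha> i j * F (i - 1) (j + 1) + wt \<beta> \<alpha> i j * F (i - 1) (j - 1) = g (i, j)"
    using weighted_system_solvable[of "wt \<alpha> \<beta>" "wt \<alpha> \<beta>" "wt \<beta> \<alpha>" "wt \<beta> \<alpha>" n "curry g"] wt_pos assms
    by auto
  show ?thesis
  proof (rule that[of "case_prod F"])
    show 1: "case_prod F x = 0" if "x \<notin> Wv n" for x using that F0 by (cases x) auto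
    show "(\<Sum>w\<in>Wv n. Kast n \<alpha> \<beta> b w * case_prod F w) = g b" if "b \<in> Bv n" for b
    proof (cases b)
      case (Pair i j)
      show ?thesis using that F[of i j] sum_Kast_row[of i j n "case_prod F", OF _ 1] unfolding Pair by simp
    qed
  qed
qed

text \<open>Exchanging the two coordinates turns the transposed system into one of the same shape.\<close>

lemma Kast_left_solvable:
  assumes "\<alpha> > 0" "\<beta> > 0"
  obtains F :: "int \<times> int \<Rightarrow> complex" where "\<And>x. x \<notin> Bv n \<Longrightarrow> F x = 0"
    and "\<And>w. w \<in> Wv n \<Longrightarrow> (\<Sum>b\<in>Bv n. F b * Kast n \<alpha> \<beta> b w) = g w"
proof -
  obtain F :: "int \<Rightarrow> int \<Rightarrow> complex" where F0: "\<And>i j. (i, j) \<notin> Wv n \<Longrightarrow> F i j = 0"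
    and F: "\<And>i j. (i, j) \<in> Bv n \<Longrightarrow>
      wt \<beta> \<alpha> (j + 1) (i + 1) * F (i + 1) (j + 1) + \<i> * wt \<alpha> \<beta> (j - 1) (i + 1) * F (i + 1) (j - 1)
      + \<i> * wt \<beta> \<alpha> (j + 1) (i - 1) * F (i - 1) (j + 1) + wt \<alpha> \<beta> (j - 1) (i - 1) * F (i - 1) (j - 1) = g (j, i)"
    using weighted_system_solvable[of "\<lambda>i j. wt \<beta> \<alpha> (j + 1) (i + 1)" "\<lambda>i j. wt \<alpha> \<beta> (j - 1) (i + 1)"
        "\<lambda>i j. wt \<beta> \<alpha> (j + 1) (i - 1)" "\<lambda>i j. wt \<alpha> \<beta> (j - 1) (i - 1)" n "\<lambda>i j. g (j, i)"] wt_pos assms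
    by auto
  show ?thesis
  proof (rule that[of "\<lambda>(i, j). F j i"])
    show 1: "(case x of (i, j) \<Rightarrow> F j i) = 0" if "x \<notin> Bv n" for x
      using that F0 by (cases x) (auto simp: swap_mem_Wv)
    show "(\<Sum>b\<in>Bv n. (case b of (i, j) \<Rightarrow> F j i) * Kast n \<alpha> \<beta> b w) = g w" if "w \<in> Wv n" for w
    proof (cases w)
      case (Pair i j)
      show ?thesis
        using that F[of j i] sum_Kast_col[of i j n "\<lambda>(i, j). F j i", OF _ 1] unfolding Pair
        by (simp add: swap_mem_Bv add_ac)
    qed
  qed
qed

section \<open>Existence and uniqueness of the two-sided inverse\<close>

lemma sum_mult_assoc_swap:
  fixes A :: "'a \<Rightarrow> 'c :: comm_semiring_1"
  shows "(\<Sum>x\<in>X. A x * (\<Sum>y\<in>Y. B x y * C y)) = (\<Sum>y\<in>Y. (\<Sum>x\<in>X. A x * B x y) * C y)"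
proof -
  have "(\<Sum>x\<in>X. A x * (\<Sum>y\<in>Y. B x y * C y)) = (\<Sum>x\<in>X. \<Sum>y\<in>Y. A x * B x y * C y)"
    by (simp add: sum_distrib_left mult.assoc)
  also have "\<dots> = (\<Sum>y\<in>Y. (\<Sum>x\<in>X. A x * B x y) * C y)"
    by (subst sum.swap) (simp add: sum_distrib_right)
  finally show ?thesis .
qed

text \<open>The usual computation \<open>S = S (K R) = (S K) R = R\<close>. It serves both to merge
  a left and a right inverse into one and to show uniqueness.\<close>

lemma left_inverse_eq_right_inverse:
  fixes R S :: "int \<times> int \<Rightarrow> int \<times> int \<Rightarrow> complex"
  assumes R: "\<And>b b'. b \<in> Bv n \<Longrightarrow> b' \<in> Bv n \<Longrightarrow>
      (\<Sum>w\<in>Wv n. Kast n \<alpha> \<beta> b w * R w b') = (if b = b' then 1 else 0)"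
    and S: "\<And>w w'. w \<in> Wv n \<Longrightarrow> w' \<in> Wv n \<Longrightarrow>
      (\<Sum>b\<in>Bv n. S w b * Kast n \<alpha> \<beta> b w') = (if w = w' then 1 else 0)"
    and w: "w \<in> Wv n" and b: "b \<in> Bv n"
  shows "S w b = R w b"
proof -
  have "S w b = (\<Sum>b'\<in>Bv n. S w b' * (if b' = b then 1 else 0))"
    using b by (simp add: if_distrib sum.delta cong: if_cong)
  also have "\<dots> = (\<Sum>b'\<in>Bv n. S w b' * (\<Sum>w'\<in>Wv n. Kast n \<alpha> \<beta> b' w' * R w' b))"
    by (intro sum.cong) (auto simp: R b)
  also have "\<dots> = (\<Sum>w'\<in>Wv n. (\<Sum>b'\<in>Bv n. S w b' * Kast n \<alpha> \<beta> b' w') * R w' b)"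
    by (rule sum_mult_assoc_swap)
  also have "\<dots> = (\<Sum>w'\<in>Wv n. if w = w' then R w' b else 0)"
    by (intro sum.cong) (auto simp: S w)
  also have "\<dots> = R w b"
    using w by simp
  finally show ?thesis .
qed

text \<open>Solving the system and its transpose for all unit vectors gives a right and a left
  inverse, which coincide. No comparison of the sizes of \<open>Wv n\<close> and \<open>Bv n\<close>
  enters.\<close>

lemma Kast_inverse_exists:
  assumes "\<alpha> > 0" "\<beta> > 0"
  obtains F :: "int \<times> int \<Rightarrow> int \<times> int \<Rightarrow> complex" where "\<And>x y. x \<notin> Wv n \<or> y \<notin> Bv n \<Longrightarrow> F x y = 0"
    "\<And>b b'. b \<in> Bv n \<Longrightarrow> b' \<in> Bv n \<Longrightarrow>
      (\<Sum>w\<in>Wv n. Kast n \<alpha> \<beta> b w * F w b') = (if b = b' then 1 else 0)"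
    "\<And>w w'. w \<in> Wv n \<Longrightarrow> w' \<in> Wv n \<Longrightarrow>
      (\<Sum>b\<in>Bv n. F w b * Kast n \<alpha> \<beta> b w') = (if w = w' then 1 else 0)"
proof -
  have "\<exists>F. \<forall>b\<in>Bv n. (\<Sum>w\<in>Wv n. Kast n \<alpha> \<beta> b w * F w) = (if b = b' then 1 else 0)" for b'
    using Kast_right_solvable[OF assms, of n "\<lambda>b. if b = b' then 1 else 0"] by metis
  then obtain R where R: "\<And>b b'. b \<in> Bv n \<Longrightarrow>
      (\<Sum>w\<in>Wv n. Kast n \<alpha> \<beta> b w * R b' w) = (if b = b' then 1 else 0)"
    by metis
  have "\<exists>F. \<forall>w'\<in>Wv n. (\<Sum>b\<in>Bv n. F b * Kast n \<alpha> \<beta> b w') = (if w = w' then 1 else 0)" for w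
    using Kast_left_solvable[OF assms, of n "\<lambda>w'. if w = w' then 1 else 0"] by metis
  then obtain S where S: "\<And>w w'. w' \<in> Wv n \<Longrightarrow>
      (\<Sum>b\<in>Bv n. S w b * Kast n \<alpha> \<beta> b w') = (if w = w' then 1 else 0)"
    by metis
  have RS: "S w b = R b w" if "w \<in> Wv n" "b \<in> Bv n" for w b
    by (rule left_inverse_eq_right_inverse[of n \<alpha> \<beta> "\<lambda>w b. R b w"]) (use R S that in auto)
  show ?thesis
  proof (rule that[of "\<lambda>w b. if w \<in> Wv n \<and> b \<in> Bv n then S w b else 0"])
    show "(\<Sum>w\<in>Wv n. Kast n \<alpha> \<beta> b w * (if w \<in> Wv n \<and> b' \<in> Bv n then S w b' else 0)) = (if b = b' then 1 else 0)"
      if "b \<in> Bv n" "b' \<in> Bv n" for b b'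
      using R[OF that(1), of b'] that(2) by (simp add: RS)
    show "(\<Sum>b\<in>Bv n. (if w \<in> Wv n \<and> b \<in> Bv n then S w b else 0) * Kast n \<alpha> \<beta> b w') = (if w = w' then 1 else 0)"
      if "w \<in> Wv n" "w' \<in> Wv n" for w w'
      using S[OF that(2), of w] that(1) by simp
  qed auto
qed

text \<open>The value zero off the diamond makes the inverse unique as a total function, so the
  definite description in \<open>Kinv_def\<close> has exactly one candidate.\<close>

lemma Kinv_spec:
  assumes "\<alpha> > 0" "\<beta> > 0"
  shows "(\<forall>x y. (x \<notin> Wv n \<or> y \<notin> Bv n) \<longrightarrow> Kinv n \<alpha> \<beta> x y = 0) \<and>
      (\<forall>b\<in>Bv n. \<forall>b'\<in>Bv n. (\<Sum>w\<in>Wv n. Kast n \<alpha> \<beta> b w * Kinv n \<alpha> \<beta> w b') = (if b = b' then 1 else 0)) \<and>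
      (\<forall>w\<in>Wv n. \<forall>w'\<in>Wv n. (\<Sum>b\<in>Bv n. Kinv n \<alpha> \<beta> w b * Kast n \<alpha> \<beta> b w') = (if w = w' then 1 else 0))"
proof -
  obtain F where F0: "\<And>x y. x \<notin> Wv n \<or> y \<notin> Bv n \<Longrightarrow> F x y = 0"
    and R: "\<And>b b'. b \<in> Bv n \<Longrightarrow> b' \<in> Bv n \<Longrightarrow>
      (\<Sum>w\<in>Wv n. Kast n \<alpha> \<beta> b w * F w b') = (if b = b' then 1 else 0)"
    and S: "\<And>w w'. w \<in> Wv n \<Longrightarrow> w' \<in> Wv n \<Longrightarrow>
      (\<Sum>b\<in>Bv n. F w b * Kast n \<alpha> \<beta> b w') = (if w = w' then 1 else 0)"
    using Kast_inverse_exists[OF assms, of n] by blast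
  show ?thesis
    unfolding Kinv_def
  proof (rule theI[where a = F])
    fix F'
    assume F': "(\<forall>x y. (x \<notin> Wv n \<or> y \<notin> Bv n) \<longrightarrow> F' x y = 0) \<and>
      (\<forall>b\<in>Bv n. \<forall>b'\<in>Bv n. (\<Sum>w\<in>Wv n. Kast n \<alpha> \<beta> b w * F' w b') = (if b = b' then 1 else 0)) \<and>
      (\<forall>w\<in>Wv n. \<forall>w'\<in>Wv n. (\<Sum>b\<in>Bv n. F' w b * Kast n \<alpha> \<beta> b w') = (if w = w' then 1 else 0))"
    have "F' w b = F w b" if "w \<in> Wv n" "b \<in> Bv n" for w b
      by (rule left_inverse_eq_right_inverse[of n \<alpha> \<beta>]) (use R F' that in auto)
    then show "F' = F" using F' F0 by (intro ext) metis
  qed (use F0 R S in auto)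
qed

text \<open>Since \<open>Kinv\<close> is a left inverse, it agrees with every right inverse; for the
  symmetries only one of the two products has to be computed.\<close>

lemma Kinv_eqI:
  fixes R :: "int \<times> int \<Rightarrow> int \<times> int \<Rightarrow> complex"
  assumes "\<alpha> > 0" "\<beta> > 0"
    and "\<And>b b'. b \<in> Bv n \<Longrightarrow> b' \<in> Bv n \<Longrightarrow>
      (\<Sum>w\<in>Wv n. Kast n \<alpha> \<beta> b w * R w b') = (if b = b' then 1 else 0)"
    and "w \<in> Wv n" "b \<in> Bv n"
  shows "Kinv n \<alpha> \<beta> w b = R w b"
  by (rule left_inverse_eq_right_inverse[OF assms(3)]) (use Kinv_spec[OF assms(1,2)] assms(4,5) in auto)

section \<open>Symmetries\<close>

text \<open>The bijections act as permutation matrices and \<open>\<phi>\<close>,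
  \<open>\<psi>\<close> as diagonal gauge factors; inverting the product of these with the second
  Kasteleyn matrix gives the claim.\<close>

lemma Kinv_transport:
  fixes \<phi> \<psi> :: "int \<times> int \<Rightarrow> complex"
  assumes pos: "\<alpha> > 0" "\<beta> > 0" "\<alpha>' > 0" "\<beta>' > 0"
    and K: "\<And>b w. b \<in> Bv n \<Longrightarrow> w \<in> Wv n \<Longrightarrow>
      Kast n \<alpha> \<beta> b w = \<phi> b * \<psi> w * Kast n \<alpha>' \<beta>' (\<tau> b) (\<sigma> w)"
    and \<tau>: "bij_betw \<tau> (Bv n) (Bv n)" and \<sigma>: "bij_betw \<sigma> (Wv n) (Wv n)"
    and nz: "\<And>b. \<phi> b \<noteq> 0" "\<And>w. \<psi> w \<noteq> 0"
    and w: "w \<in> Wv n" and b: "b \<in> Bv n"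
  shows "Kinv n \<alpha> \<beta> w b = inverse (\<phi> b * \<psi> w) * Kinv n \<alpha>' \<beta>' (\<sigma> w) (\<tau> b)"
proof (rule Kinv_eqI[OF pos(1,2) _ w b])
  fix b b' assume b: "b \<in> Bv n" "b' \<in> Bv n"
  have \<tau>b: "\<tau> b \<in> Bv n" "\<tau> b' \<in> Bv n" using \<tau> b by (auto simp: bij_betw_def)
  have eq: "\<tau> b = \<tau> b' \<longleftrightarrow> b = b'" using \<tau> b by (auto simp: bij_betw_def inj_on_def)
  have "(\<Sum>w\<in>Wv n. Kast n \<alpha> \<beta> b w * (inverse (\<phi> b' * \<psi> w) * Kinv n \<alpha>' \<beta>' (\<sigma> w) (\<tau> b')))
      = (\<Sum>w\<in>Wv n. \<phi> b / \<phi> b' * (Kast n \<alpha>' \<beta>' (\<tau> b) (\<sigma> w) * Kinv n \<alpha>' \<beta>' (\<sigma> w) (\<tau> b')))"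
    using b nz by (intro sum.cong) (auto simp: K field_simps)
  also have "\<dots> = \<phi> b / \<phi> b' * (\<Sum>w\<in>Wv n. Kast n \<alpha>' \<beta>' (\<tau> b) (\<sigma> w) * Kinv n \<alpha>' \<beta>' (\<sigma> w) (\<tau> b'))"
    by (simp add: sum_distrib_left)
  also have "(\<Sum>w\<in>Wv n. Kast n \<alpha>' \<beta>' (\<tau> b) (\<sigma> w) * Kinv n \<alpha>' \<beta>' (\<sigma> w) (\<tau> b'))
      = (\<Sum>w\<in>Wv n. Kast n \<alpha>' \<beta>' (\<tau> b) w * Kinv n \<alpha>' \<beta>' w (\<tau> b'))"
    by (rule sum.reindex_bij_betw[OF \<sigma>])
  also have "\<dots> = (if b = b' then 1 else 0)"
    using Kinv_spec[OF pos(3,4), of n] \<tau>b eq by simp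
  \<comment> \<open>The remaining factor \<open>\<phi> b / \<phi> b'\<close> is 1 on the diagonal
    and is multiplied by 0 off it.\<close>
  finally show "(\<Sum>w\<in>Wv n. Kast n \<alpha> \<beta> b w * (inverse (\<phi> b' * \<psi> w) * Kinv n \<alpha>' \<beta>' (\<sigma> w) (\<tau> b'))) = (if b = b' then 1 else 0)"
    using nz by simp
qed

text \<open>The half-turn reverses every edge, which exchanges the parameters, and replaces
  \<open>i + j\<close> by \<open>4 * n - (i + j)\<close>, which exchanges the classes 1 and 3 modulo
  4. The two exchanges cancel.\<close>

lemma Kinv_rotate:
  assumes "\<alpha> > 0" "\<beta> > 0" and w: "(i, j) \<in> Wv n" and b: "(k, l) \<in> Bv n"
  shows "Kinv n \<alpha> \<beta> (i, j) (k, l) =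
         Kinv n \<alpha> \<beta> (2 * int n - i, 2 * int n - j) (2 * int n - k, 2 * int n - l)"
proof -
  define \<rho> where "\<rho> = (\<lambda>(i, j). (2 * int n - i, 2 * int n - j))"
  have bij: "bij_betw \<rho> (Wv n) (Wv n)" "bij_betw \<rho> (Bv n) (Bv n)"
    by (rule bij_betw_byWitness[where f' = \<rho>]; auto simp: \<rho>_def Wv_def Bv_def)+
  have "Kinv n \<alpha> \<beta> (i, j) (k, l) = inverse (1 * 1) * Kinv n \<alpha> \<beta> (\<rho> (i, j)) (\<rho> (k, l))"
  proof (rule Kinv_transport[where \<phi> = "\<lambda>_. 1" and \<psi> = "\<lambda>_. 1", OF assms(1,2,1,2) _ bij(2,1) _ _ w b])
    fix b w :: "int \<times> int" assume bw: "b \<in> Bv n" "w \<in> Wv n"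
    obtain i j k l where [simp]: "b = (i, j)" "w = (k, l)" by fastforce
    have "odd (i + j)" using bw by (auto simp: Bv_def)
    then have "(2 * int n - i + (2 * int n - j)) mod 4 = 1 \<longleftrightarrow> (i + j) mod 4 \<noteq> 1" by presburger
    then have wt: "wt \<gamma> \<delta> (2 * int n - i) (2 * int n - j) = wt \<delta> \<gamma> i j" for \<gamma> \<delta>
      by (simp add: wt_def)
    have "\<rho> b \<in> Bv n" "\<rho> w \<in> Wv n" using bij bw by (auto simp: bij_betw_def)
    then show "Kast n \<alpha> \<beta> b w = 1 * 1 * Kast n \<alpha> \<beta> (\<rho> b) (\<rho> w)"
      using bw by (auto simp: Kast_eq_wt \<rho>_def wt)
  qed auto
  then show ?thesis by (simp add: \<rho>_def)
qed

text \<open>Left and right edges are exchanged, while the classes stay: for a vertex of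
  \<open>Bv\<close> the first coordinate is even and \<open>2 * n\<close> is divisible by 4. Hence
  the parameters are exchanged. The factors \<open>\<i>\<close> now sit on the wrong diagonal
  direction, which a gauge repairs.\<close>

lemma Kinv_reflect:
  assumes "even n" "\<alpha> > 0" "\<beta> > 0" and w: "(i, j) \<in> Wv n" and b: "(k, l) \<in> Bv n"
  shows "Kinv n \<alpha> \<beta> (i, j) (k, l) =
         \<i> powi (k + l - i - j - 1) * Kinv n \<beta> \<alpha> (2 * int n - i, j) (2 * int n - k, l)"
proof -
  define \<rho> where "\<rho> = (\<lambda>(i, j :: int). (2 * int n - i, j))"
  have bij: "bij_betw \<rho> (Wv n) (Wv n)" "bij_betw \<rho> (Bv n) (Bv n)"
    by (rule bij_betw_byWitness[where f' = \<rho>]; auto simp: \<rho>_def Wv_def Bv_def)+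
  \<comment> \<open>Along an edge \<open>\<phi> b * \<psi> w\<close> depends on the displacement
    only: it is \<open>- \<i>\<close> for the directions of \<open>(1, 1)\<close> and
    \<open>\<i>\<close> for those of \<open>(-1, 1)\<close>. This is the factor that moves the
    \<open>\<i>\<close> back to the second kind.\<close>
  define \<phi> :: "int \<times> int \<Rightarrow> complex" where "\<phi> = (\<lambda>(k, l). \<i> powi (1 - k - l))"
  define \<psi> :: "int \<times> int \<Rightarrow> complex" where "\<psi> = (\<lambda>(i, j). \<i> powi (i + j))"
  have "Kinv n \<alpha> \<beta> (i, j) (k, l) = inverse (\<phi> (k, l) * \<psi> (i, j)) * Kinv n \<beta> \<alpha> (\<rho> (i, j)) (\<rho> (k, l))"
  proof (rule Kinv_transport[OF assms(2,3,3,2) _ bij(2,1) _ _ w b])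
    fix b w :: "int \<times> int" assume bw: "b \<in> Bv n" "w \<in> Wv n"
    obtain i j k l where [simp]: "b = (i, j)" "w = (k, l)" by fastforce
    have "even i" using bw by (auto simp: Bv_def)
    then have "(2 * int n - i + j) mod 4 = 1 \<longleftrightarrow> (i + j) mod 4 = 1"
      using \<open>even n\<close> by presburger
    then have wt: "wt \<gamma> \<delta> (2 * int n - i) j = wt \<gamma> \<delta> i j" for \<gamma> \<delta>
      by (simp add: wt_def)
    have \<rho>: "\<rho> b \<in> Bv n" "\<rho> w \<in> Wv n" using bij bw by (auto simp: bij_betw_def)
    have gauge: "\<phi> b * \<psi> w = \<i> powi (1 + (k - i) + (l - j))"
      by (simp add: \<phi>_def \<psi>_def flip: power_int_add) (simp add: algebra_simps)
    show "Kast n \<alpha> \<beta> b w = \<phi> b * \<psi> w * Kast n \<beta> \<alpha> (\<rho> b) (\<rho> w)"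
      unfolding gauge using bw \<rho> by (auto simp: Kast_eq_wt \<rho>_def wt power_int_def power3_eq_cube)
  qed (auto simp: \<phi>_def \<psi>_def)
  also have "inverse (\<phi> (k, l) * \<psi> (i, j)) = \<i> powi (k + l - i - j - 1)"
    by (simp add: \<phi>_def \<psi>_def flip: power_int_add power_int_minus) (simp add: algebra_simps)
  finally show ?thesis by (simp add: \<rho>_def)
qed

section \<open>The adjugate relations\<close>

text \<open>For a vertex of either colour, the index of the class \<open>Weps\<close> or
  \<open>Beps\<close> that contains it.\<close>

definition vcls :: "int \<times> int \<Rightarrow> nat" where
  "vcls x = (if (fst x + snd x) mod 4 = 1 then 0 else 1)"

text \<open>
  With \<open>u\<close> and \<open>v\<close> the monomials of \<open>e\<^sub>2\<close> and \<open>e\<^sub>1\<close>, \<open>adjP\<close> and \<open>adjQ\<close> are the sums of a row and of a column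
  of the (negated) adjugate of the symbol of the Kasteleyn matrix.
\<close>

definition adjP :: "real \<Rightarrow> nat \<Rightarrow> complex \<Rightarrow> complex \<Rightarrow> complex" where
  "adjP a \<epsilon> w1 w2 = (let A = complex_of_real a; v = w1 * w2; u = w2 / w1 in
     if \<epsilon> = 0 then inverse v + A * v - \<i> * (A * inverse u + u)
     else A * inverse v + v - \<i> * (inverse u + A * u))"

definition adjQ :: "real \<Rightarrow> nat \<Rightarrow> complex \<Rightarrow> complex \<Rightarrow> complex" where
  "adjQ a \<epsilon> b1 b2 = (let A = complex_of_real a; v = b1 * b2; u = b2 / b1 in
     if \<epsilon> = 0 then inverse v + A * v - \<i> * (inverse u + A * u)
     else A * inverse v + v - \<i> * (A * inverse u + u))"

lemma shifted_mod4:
  fixes i j :: int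
  assumes "odd (i + j)"
  shows "(i + 1 + (j + 1)) mod 4 = 1 \<longleftrightarrow> (i + j) mod 4 \<noteq> 1"
    "(i - 1 + (j - 1)) mod 4 = 1 \<longleftrightarrow> (i + j) mod 4 \<noteq> 1"
    "(i + 1 + (j - 1)) mod 4 = 1 \<longleftrightarrow> (i + j) mod 4 = 1"
    "(i - 1 + (j + 1)) mod 4 = 1 \<longleftrightarrow> (i + j) mod 4 = 1"
  using assms by presburger+

text \<open>In the whole plane the adjugate times the symbol leaves \<open>cdel\<close> times the
  monomial. On the rows \<open>j = 0\<close> and \<open>j = 2 * int n\<close> two of the four
  neighbours are missing; \<open>sek\<close> times \<open>w1 powi i\<close> is minus their
  contribution.\<close>

lemma adjP_Kast:
  assumes x: "(i, j) \<in> Wv n" and w: "w1 \<noteq> 0" "w2 \<noteq> 0"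
  shows "(\<Sum>b\<in>Bv n. adjP a (vcls b) w1 w2 * w1 powi fst b * w2 powi snd b * Kast n a 1 b (i, j))
    = cdel a w1 w2 * w1 powi i * w2 powi j + sek a n (vcls (i, j)) j w1 w2 * w1 powi i"
    (is "?lhs = ?rhs")
proof -
  define H where "H b = adjP a (vcls b) w1 w2 * w1 powi fst b * w2 powi snd b" for b
  define G where "G b = (if b \<in> Bv n then H b else 0)" for b
  have "?lhs = (\<Sum>b\<in>Bv n. G b * Kast n a 1 b (i, j))"
    by (intro sum.cong) (simp_all add: G_def H_def)
  also have "\<dots> = wt 1 a (i + 1) (j + 1) * G (i + 1, j + 1) + \<i> * wt 1 a (i + 1) (j - 1) * G (i + 1, j - 1)
           + \<i> * wt a 1 (i - 1) (j + 1) * G (i - 1, j + 1) + wt a 1 (i - 1) (j - 1) * G (i - 1, j - 1)"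
    by (rule sum_Kast_col[OF x]) (simp add: G_def)
  also have "\<dots> = ?rhs"
  proof -
    have odd: "odd (i + j)" and ij: "odd i" "even j" "1 \<le> i" "i \<le> 2 * int n - 1" "0 \<le> j" "j \<le> 2 * int n"
      using x by (auto simp: Wv_def)
    have pw: "w1 powi (i + 1) = w1 powi i * w1" "w1 powi (i - 1) = w1 powi i / w1"
      "w2 powi (j + 1) = w2 powi j * w2" "w2 powi (j - 1) = w2 powi j / w2"
      using w by (simp_all add: power_int_add power_int_diff)
    \<comment> \<open>With inverses, powers and constants replaced by variables, every case becomes
      a polynomial identity modulo the three relations in \<open>wi\<close>.\<close>
    obtain p q X Y Z A I :: complex where e: "inverse w1 = p" "inverse w2 = q" "w1 powi i = X" "w2 powi j = Y"
      "w2 ^ (2 * n) = Z" "complex_of_real a = A" "\<i> = I" by blast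
    obtain c where c: "(i + j) mod 4 = 1 \<longleftrightarrow> c" by blast
    have wi: "w1 * inverse w1 = 1" "w2 * inverse w2 = 1" "\<i> * \<i> = -1" using w by simp_all
    note unf = adjP_def vcls_def wt_def fst_conv snd_conv shifted_mod4[OF odd] pw
      cdel_def s0_def s2n_def Let_def divide_inverse power_inverse[symmetric] inverse_mult_distrib inverse_inverse_eq
    note simps = simp_thms not_True_eq_False if_True if_False of_real_1 diff_zero diff_self_eq_0
      mult_zero_right mult_zero_left mult_1_left mult_1_right add_0_left add_0_right power_0
      zero_neq_one one_neq_zero arith_simps
    consider "j = 0" | "j = 2 * int n" "j \<noteq> 0" | "j \<noteq> 0" "j \<noteq> 2 * int n" by blast
    then show ?thesis
    proof cases
      case 1
      have G: "G (k, j - 1) = 0" "G (i + 1, j + 1) = H (i + 1, j + 1)" "G (i - 1, j + 1) = H (i - 1, j + 1)" for k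
        using 1 ij by (auto simp: G_def Bv_def)
      have eqs: "sek a n \<epsilon> j w1 w2 = s0 a \<epsilon> w1 w2" "w2 powi j = 1" for \<epsilon>
        using 1 by (simp_all add: sek_def)
      show ?thesis
        unfolding G H_def eqs unf
        by (insert wi, unfold e c)
          (cases c; simp only: e simps; algebra)
    next
      case 2
      have G: "G (k, j + 1) = 0" "G (i + 1, j - 1) = H (i + 1, j - 1)" "G (i - 1, j - 1) = H (i - 1, j - 1)" for k
        using 2 ij by (auto simp: G_def Bv_def)
      have eqs: "sek a n \<epsilon> j w1 w2 = s2n a n \<epsilon> w1 w2" "w2 powi j = w2 ^ (2 * n)" for \<epsilon>
        using 2 power_int_of_nat[of w2 "2 * n"] by (simp_all add: sek_def)
      show ?thesis
        unfolding G H_def eqs unf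
        by (insert wi, unfold e c)
          (cases c; simp only: e simps; algebra)
    next
      case 3
      have "j \<noteq> 2 * int n - 1" "j \<noteq> 1" using ij by auto
      then have G: "G (i + 1, j + 1) = H (i + 1, j + 1)" "G (i - 1, j + 1) = H (i - 1, j + 1)"
         "G (i + 1, j - 1) = H (i + 1, j - 1)" "G (i - 1, j - 1) = H (i - 1, j - 1)"
        using 3 ij by (auto simp: G_def Bv_def)
      have eqs: "sek a n \<epsilon> j w1 w2 = 0" for \<epsilon> using 3 by (simp add: sek_def)
      show ?thesis
        unfolding G H_def eqs unf
        by (insert wi, unfold e c)
          (cases c; simp only: e simps; algebra)
    qed
  qed
  finally show ?thesis .
qed

text \<open>The transposed computation. Neighbours are now cut off at the vertical sides
  \<open>i = 0\<close> and \<open>i = 2 * int n\<close>, so the arguments of \<open>sek\<close>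
  appear in the opposite order.\<close>

lemma adjQ_Kast:
  assumes y: "(i, j) \<in> Bv n" and b: "b1 \<noteq> 0" "b2 \<noteq> 0"
  shows "(\<Sum>w\<in>Wv n. Kast n a 1 (i, j) w * (adjQ a (vcls w) b1 b2 * b1 powi fst w * b2 powi snd w))
    = cdel a b1 b2 * b1 powi i * b2 powi j + sek a n (vcls (i, j)) i b2 b1 * b2 powi j"
    (is "?lhs = ?rhs")
proof -
  define H where "H x = adjQ a (vcls x) b1 b2 * b1 powi fst x * b2 powi snd x" for x
  define G where "G x = (if x \<in> Wv n then H x else 0)" for x
  have "?lhs = (\<Sum>x\<in>Wv n. Kast n a 1 (i, j) x * G x)"
    by (intro sum.cong) (simp_all add: G_def H_def)
  also have "\<dots> = wt a 1 i j * G (i + 1, j + 1) + \<i> * wt a 1 i j * G (i + 1, j - 1)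
           + \<i> * wt 1 a i j * G (i - 1, j + 1) + wt 1 a i j * G (i - 1, j - 1)"
    by (rule sum_Kast_row[OF y]) (simp add: G_def)
  also have "\<dots> = ?rhs"
  proof -
    have odd: "odd (i + j)" and ij: "even i" "odd j" "0 \<le> i" "i \<le> 2 * int n" "1 \<le> j" "j \<le> 2 * int n - 1"
      using y by (auto simp: Bv_def)
    have pw: "b1 powi (i + 1) = b1 powi i * b1" "b1 powi (i - 1) = b1 powi i / b1"
      "b2 powi (j + 1) = b2 powi j * b2" "b2 powi (j - 1) = b2 powi j / b2"
      using b by (simp_all add: power_int_add power_int_diff)
    obtain p q X Y Z A I :: complex where e: "inverse b1 = p" "inverse b2 = q" "b1 powi i = X" "b2 powi j = Y"
      "b1 ^ (2 * n) = Z" "complex_of_real a = A" "\<i> = I" by blast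
    obtain c where c: "(i + j) mod 4 = 1 \<longleftrightarrow> c" by blast
    have wi: "b1 * inverse b1 = 1" "b2 * inverse b2 = 1" "\<i> * \<i> = -1" using b by simp_all
    note unf = adjQ_def vcls_def wt_def fst_conv snd_conv shifted_mod4[OF odd] pw
      cdel_def s0_def s2n_def Let_def divide_inverse power_inverse[symmetric] inverse_mult_distrib inverse_inverse_eq
    note simps = simp_thms not_True_eq_False if_True if_False of_real_1 diff_zero diff_self_eq_0
      mult_zero_right mult_zero_left mult_1_left mult_1_right add_0_left add_0_right power_0
      zero_neq_one one_neq_zero arith_simps
    consider "i = 0" | "i = 2 * int n" "i \<noteq> 0" | "i \<noteq> 0" "i \<noteq> 2 * int n" by blast
    then show ?thesis
    proof cases
      case 1
      have G: "G (i - 1, k) = 0" "G (i + 1, j + 1) = H (i + 1, j + 1)" "G (i + 1, j - 1) = H (i + 1, j - 1)" for k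
        using 1 ij by (auto simp: G_def Wv_def)
      have eqs: "sek a n \<epsilon> i b2 b1 = s0 a \<epsilon> b2 b1" "b1 powi i = 1" for \<epsilon>
        using 1 by (simp_all add: sek_def)
      show ?thesis
        unfolding G H_def eqs unf
        by (insert wi, unfold e c)
          (cases c; simp only: e simps; algebra)
    next
      case 2
      have G: "G (i + 1, k) = 0" "G (i - 1, j + 1) = H (i - 1, j + 1)" "G (i - 1, j - 1) = H (i - 1, j - 1)" for k
        using 2 ij by (auto simp: G_def Wv_def)
      have eqs: "sek a n \<epsilon> i b2 b1 = s2n a n \<epsilon> b2 b1" "b1 powi i = b1 ^ (2 * n)" for \<epsilon>
        using 2 power_int_of_nat[of b1 "2 * n"] by (simp_all add: sek_def)
      show ?thesis
        unfolding G H_def eqs unf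
        by (insert wi, unfold e c)
          (cases c; simp only: e simps; algebra)
    next
      case 3
      have "i \<noteq> 2 * int n - 1" "i \<noteq> 1" using ij by auto
      then have G: "G (i + 1, j + 1) = H (i + 1, j + 1)" "G (i - 1, j + 1) = H (i - 1, j + 1)"
         "G (i + 1, j - 1) = H (i + 1, j - 1)" "G (i - 1, j - 1) = H (i - 1, j - 1)"
        using 3 ij by (auto simp: G_def Wv_def)
      have eqs: "sek a n \<epsilon> i b2 b1 = 0" for \<epsilon> using 3 by (simp add: sek_def)
      show ?thesis
        unfolding G H_def eqs unf
        by (insert wi, unfold e c)
          (cases c; simp only: e simps; algebra)
    qed
  qed
  finally show ?thesis .
qed

section \<open>Diagonal and one-sided terms\<close>

lemma sum_lessThan_double: "(\<Sum>t<2 * r. f t) = (\<Sum>t<r. f (2 * t) + f (2 * t + 1))"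
  for f :: "nat \<Rightarrow> 'a :: comm_monoid_add"
  by (induction r) (simp_all add: add_ac)

lemma sum_Bv: "(\<Sum>y\<in>Bv n. h y) = (\<Sum>t\<le>n. \<Sum>k<n. h (2 * int t, 2 * int k + 1))"
proof -
  have "(\<Sum>y\<in>Bv n. h y) = (\<Sum>(t, k)\<in>{..n} \<times> {..<n}. h (2 * int t, 2 * int k + 1))"
    by (rule sum.reindex_bij_witness[where j = "\<lambda>(i, j). (nat (i div 2), nat (j div 2))"
          and i = "\<lambda>(t, k). (2 * int t, 2 * int k + 1)"]) (auto simp: Bv_def)
  then show ?thesis by (simp add: sum.cartesian_product)
qed

lemma sum_Wv: "(\<Sum>x\<in>Wv n. h x) = (\<Sum>t<n. \<Sum>k\<le>n. h (2 * int t + 1, 2 * int k))"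
proof -
  have "(\<Sum>x\<in>Wv n. h x) = (\<Sum>(t, k)\<in>{..<n} \<times> {..n}. h (2 * int t + 1, 2 * int k))"
    by (rule sum.reindex_bij_witness[where j = "\<lambda>(i, j). (nat (i div 2), nat (j div 2))"
          and i = "\<lambda>(t, k). (2 * int t + 1, 2 * int k)"]) (auto simp: Wv_def)
  then show ?thesis by (simp add: sum.cartesian_product)
qed

text \<open>Because \<open>fk\<close> is a sum and not a quotient, this includes
  \<open>t = 1\<close>, and no such values of the variables have to be excluded later.\<close>

lemma fk_geometric: "t ^ r = 1 + (t - 1) * fk r t"
  by (simp add: fk_def flip: power_diff_1_eq)

lemma vcls_parity:
  "vcls (2 * int (2 * t), 2 * int (2 * k) + 1) = 0" "vcls (2 * int (2 * t), 2 * int (2 * k + 1) + 1) = 1"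
  "vcls (2 * int (2 * t + 1), 2 * int (2 * k) + 1) = 1" "vcls (2 * int (2 * t + 1), 2 * int (2 * k + 1) + 1) = 0"
  "vcls (2 * int (2 * t) + 1, 2 * int (2 * k)) = 0" "vcls (2 * int (2 * t + 1) + 1, 2 * int (2 * k)) = 1"
  unfolding vcls_def fst_conv snd_conv by presburger+

lemma powi_parity:
  fixes x :: complex
  shows
  "x powi (2 * int (2 * t)) = (x ^ 4) ^ t" "x powi (2 * int (2 * t) + 1) = x * (x ^ 4) ^ t"
  "x powi (2 * int (2 * t + 1)) = x\<^sup>2 * (x ^ 4) ^ t" "x powi (2 * int (2 * t + 1) + 1) = x ^ 3 * (x ^ 4) ^ t"
proof -
  have e: "2 * int (2 * t) = int (4 * t)" "2 * int (2 * t) + 1 = int (4 * t + 1)"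
    "2 * int (2 * t + 1) = int (4 * t + 2)" "2 * int (2 * t + 1) + 1 = int (4 * t + 3)"
    by simp_all
  show "x powi (2 * int (2 * t)) = (x ^ 4) ^ t"
    by (simp only: e(1) power_int_of_nat power_mult)
  show "x powi (2 * int (2 * t) + 1) = x * (x ^ 4) ^ t"
    unfolding e(2) power_int_of_nat power_add power_mult power_one_right by (rule mult.commute)
  show "x powi (2 * int (2 * t + 1)) = x\<^sup>2 * (x ^ 4) ^ t"
    unfolding e(3) power_int_of_nat power_add power_mult power_one_right by (rule mult.commute)
  show "x powi (2 * int (2 * t + 1) + 1) = x ^ 3 * (x ^ 4) ^ t"
    unfolding e(4) power_int_of_nat power_add power_mult power_one_right by (rule mult.commute)
qed

lemma adjP_expand:
  "adjP a 0 w1 w2 = inverse w1 * inverse w2 + complex_of_real a * (w1 * w2)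
    - \<i> * (complex_of_real a * (inverse w2 * w1) + w2 * inverse w1)"
  "adjP a 1 w1 w2 = complex_of_real a * (inverse w1 * inverse w2) + w1 * w2
    - \<i> * (inverse w2 * w1 + complex_of_real a * (w2 * inverse w1))"
  by (simp_all add: adjP_def Let_def divide_inverse)

lemma adjQ_expand:
  "adjQ a 0 b1 b2 = inverse b1 * inverse b2 + complex_of_real a * (b1 * b2)
    - \<i> * (inverse b2 * b1 + complex_of_real a * (b2 * inverse b1))"
  "adjQ a 1 b1 b2 = complex_of_real a * (inverse b1 * inverse b2) + b1 * b2
    - \<i> * (complex_of_real a * (inverse b2 * b1) + b2 * inverse b1)"
  by (simp_all add: adjQ_def Let_def divide_inverse)

text \<open>The class alternates in both directions, so the vertices group into blocks of two by
  two, which contribute geometric sums in \<open>x1 ^ 4\<close> and \<open>x2 ^ 4\<close>.\<close>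

lemma sum_adjP:
  assumes n: "n = 2 * r"
  shows "(\<Sum>y\<in>Bv n. adjP a (vcls y) w1 w2 * x1 powi fst y * x2 powi snd y) =
    fk r (x2 ^ 4) * (fk r (x1 ^ 4) * (adjP a 0 w1 w2 * x2 + adjP a 1 w1 w2 * x2 ^ 3
        + (adjP a 1 w1 w2 * x2 + adjP a 0 w1 w2 * x2 ^ 3) * x1\<^sup>2)
      + x1 ^ (4 * r) * (adjP a 0 w1 w2 * x2 + adjP a 1 w1 w2 * x2 ^ 3))"
proof -
  \<comment> \<open>\<open>E\<close> and \<open>O'\<close> are the contributions of two consecutive
    vertices in a column of even and of odd index.\<close>
  define E where "E = adjP a 0 w1 w2 * x2 + adjP a 1 w1 w2 * x2 ^ 3"
  define O' where "O' = adjP a 1 w1 w2 * x2 + adjP a 0 w1 w2 * x2 ^ 3"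
  define h where "h y = adjP a (vcls y) w1 w2 * x1 powi fst y * x2 powi snd y" for y
  have row0: "(\<Sum>k<n. h (2 * int (2 * t), 2 * int k + 1)) = E * fk r (x2 ^ 4) * (x1 ^ 4) ^ t" for t
    unfolding n sum_lessThan_double h_def fst_conv snd_conv vcls_parity powi_parity fk_def E_def
      sum_distrib_left sum_distrib_right
    by (intro sum.cong) (simp_all add: algebra_simps power_numeral_reduce)
  have row1: "(\<Sum>k<n. h (2 * int (2 * t + 1), 2 * int k + 1)) = O' * fk r (x2 ^ 4) * x1\<^sup>2 * (x1 ^ 4) ^ t" for t
    unfolding n sum_lessThan_double h_def fst_conv snd_conv vcls_parity powi_parity fk_def O'_def
      sum_distrib_left sum_distrib_right
    by (intro sum.cong) (simp_all add: algebra_simps power_numeral_reduce)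
  \<comment> \<open>There are \<open>n + 1\<close> columns, an odd number: \<open>r\<close> pairs
    and one last column of the same type as the even ones, which produces the term with
    \<open>x1 ^ (4 * r)\<close>.\<close>
  have "(\<Sum>y\<in>Bv n. h y) = (\<Sum>t<2 * r. \<Sum>k<n. h (2 * int t, 2 * int k + 1)) + (\<Sum>k<n. h (2 * int n, 2 * int k + 1))"
    unfolding sum_Bv by (simp add: n flip: lessThan_Suc_atMost)
  also have "(\<Sum>t<2 * r. \<Sum>k<n. h (2 * int t, 2 * int k + 1)) =
      (\<Sum>t<r. E * fk r (x2 ^ 4) * (x1 ^ 4) ^ t + O' * fk r (x2 ^ 4) * x1\<^sup>2 * (x1 ^ 4) ^ t)"
    unfolding sum_lessThan_double row0 row1 ..
  also have "\<dots> = fk r (x2 ^ 4) * fk r (x1 ^ 4) * (E + O' * x1\<^sup>2)"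
    by (simp add: fk_def[of r "x1 ^ 4"] sum.distrib algebra_simps flip: sum_distrib_left)
  also have "(\<Sum>k<n. h (2 * int n, 2 * int k + 1)) = E * fk r (x2 ^ 4) * x1 ^ (4 * r)"
    unfolding n row0[of r, unfolded n] by (simp add: power_mult)
  finally show ?thesis unfolding h_def E_def O'_def by (simp add: algebra_simps)
qed

text \<open>The right-hand side is the part of \<open>dfun\<close> without \<open>dsides\<close>; it
  collects the diagonal terms, in which the variables occur as \<open>w1 * b1\<close> and
  \<open>w2 * b2\<close>.\<close>

lemma sum_adjP_closed:
  assumes n: "n = 2 * r" and nz: "w1 \<noteq> 0" "w2 \<noteq> 0" "b1 \<noteq> 0" "b2 \<noteq> 0"
  shows "(\<Sum>y\<in>Bv n. adjP a (vcls y) w1 w2 * (w1 * b1) powi fst y * (w2 * b2) powi snd y) =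
    (let A = complex_of_real a in
       fk r (w2 ^ 4 * b2 ^ 4) * fk r (w1 ^ 4 * b1 ^ 4) * b2 * w1
         * (A + w1\<^sup>2 * b1\<^sup>2 + w2\<^sup>2 * b2\<^sup>2 * (1 + A * w1\<^sup>2 * b1\<^sup>2))
         * (w2\<^sup>2 + b1\<^sup>2 - \<i> * (1 + w2\<^sup>2 * b1\<^sup>2))
     + ((1 - \<i> * w2\<^sup>2) * inverse w1 * b2 * (1 + A * w2\<^sup>2 * b2\<^sup>2)
        + (w2\<^sup>2 - \<i>) * w1 ^ (2 * n + 1) * b1 ^ (2 * n) * b2 * (A + w2\<^sup>2 * b2\<^sup>2)) * fk r (w2 ^ 4 * b2 ^ 4))"
proof -
  have geo: "(w1 * b1) ^ (4 * r) = 1 + ((w1 * b1) ^ 4 - 1) * fk r ((w1 * b1) ^ 4)"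
    using fk_geometric[of "(w1 * b1) ^ 4" r] by (simp add: power_mult)
  have top: "w1 ^ (2 * n + 1) * b1 ^ (2 * n) = w1 * (w1 * b1) ^ (4 * r)"
    by (simp add: n power_mult_distrib)
  obtain p q A I :: complex where e: "inverse w1 = p" "inverse w2 = q" "complex_of_real a = A" "\<i> = I" by blast
  have wi: "w1 * p = 1" "w2 * q = 1" "I * I = -1" using nz e by auto
  define P0 P1 where "P0 = adjP a 0 w1 w2" and "P1 = adjP a 1 w1 w2"
  have P: "P0 = p * q + A * (w1 * w2) - I * (A * (q * w1) + w2 * p)" "P1 = A * (p * q) + w1 * w2 - I * (q * w1 + A * (w2 * p))"
    unfolding P0_def P1_def adjP_expand e by simp_all
  \<comment> \<open>\<open>U\<close> and \<open>V\<close> are the parts of an even column that carry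
    \<open>inverse w1\<close> and \<open>w1\<close>. In the last column the power
    \<open>(w1 * b1) ^ (4 * r)\<close> is expanded by \<open>fk_geometric\<close> for
    \<open>U\<close> and kept for \<open>V\<close>; \<open>R\<close> is what then multiplies both
    geometric sums.\<close>
  define U V R where "U = (1 - I * w2\<^sup>2) * p * b2 * (1 + A * w2\<^sup>2 * b2\<^sup>2)"
    and "V = (w2\<^sup>2 - I) * w1 * b2 * (A + w2\<^sup>2 * b2\<^sup>2)"
    and "R = b2 * w1 * (A + w1\<^sup>2 * b1\<^sup>2 + w2\<^sup>2 * b2\<^sup>2 * (1 + A * w1\<^sup>2 * b1\<^sup>2)) * (w2\<^sup>2 + b1\<^sup>2 - I * (1 + w2\<^sup>2 * b1\<^sup>2))"
  have 1: "P0 * (w2 * b2) + P1 * (w2 * b2) ^ 3 = U + V"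
    unfolding P U_def V_def using wi by algebra
  have 2: "U + V + (P1 * (w2 * b2) + P0 * (w2 * b2) ^ 3) * (w1 * b1)\<^sup>2 + ((w1 * b1) ^ 4 - 1) * U = R"
    unfolding P U_def V_def R_def using wi by algebra
  define f g Z where "f = fk r ((w1 * b1) ^ 4)" and "g = fk r ((w2 * b2) ^ 4)" and "Z = (w1 * b1) ^ (4 * r)"
  have Z: "Z = 1 + ((w1 * b1) ^ 4 - 1) * f" using geo by (simp add: f_def Z_def)
  have lhs: "g * (f * (U + V + (P1 * (w2 * b2) + P0 * (w2 * b2) ^ 3) * (w1 * b1)\<^sup>2) + Z * (U + V)) = g * (f * R + U + V * Z)"
    unfolding 2[symmetric] Z by (simp add: algebra_simps)
  have VZ: "V * Z = (w2\<^sup>2 - I) * w1 ^ (2 * n + 1) * b1 ^ (2 * n) * b2 * (A + w2\<^sup>2 * b2\<^sup>2)"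
  proof -
    have "V * Z = (w2\<^sup>2 - I) * (w1 * Z) * b2 * (A + w2\<^sup>2 * b2\<^sup>2)" by (simp add: V_def mult_ac)
    then show ?thesis unfolding Z_def top[symmetric] by (simp only: mult.assoc)
  qed
  have R: "g * f * b2 * w1 * (A + w1\<^sup>2 * b1\<^sup>2 + w2\<^sup>2 * b2\<^sup>2 * (1 + A * w1\<^sup>2 * b1\<^sup>2))
      * (w2\<^sup>2 + b1\<^sup>2 - I * (1 + w2\<^sup>2 * b1\<^sup>2)) = g * (f * R)"
    by (simp only: R_def mult.assoc)
  show ?thesis
    unfolding sum_adjP[OF n] Let_def P0_def[symmetric] P1_def[symmetric] 1 f_def[symmetric] g_def[symmetric] Z_def[symmetric]
      power_mult_distrib[of w1 b1 4, symmetric] power_mult_distrib[of w2 b2 4, symmetric] e R lhs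
      U_def[symmetric] VZ[symmetric]
    by (simp add: algebra_simps)
qed

text \<open>Only the bottom and the top row contribute. As \<open>2 * n\<close> is divisible by 4,
  the class of a vertex there depends on its first coordinate alone, and pairs of neighbouring first
  coordinates form a geometric sum with coefficient \<open>dsides\<close>.\<close>

lemma sum_sek_adjQ:
  assumes n: "n = 4 * m" and nz: "w1 \<noteq> 0" "w2 \<noteq> 0" "b1 \<noteq> 0" "b2 \<noteq> 0"
  shows "(\<Sum>x\<in>Wv n. sek a n (vcls x) (snd x) w1 w2 * w1 powi fst x
            * (adjQ a (vcls x) b1 b2 * b1 powi fst x * b2 powi snd x)) =
         dsides a n w1 w2 b1 b2 * fk (n div 2) (w1 ^ 4 * b1 ^ 4)"
\<comment> \<open>For \<open>n = 0\<close> the two rows would coincide, but both sides are then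
  empty sums.\<close>
proof (cases "n = 0")
  case True
  then show ?thesis by (auto simp: fk_def Wv_def intro!: sum.neutral)
next
  case False
  define r where "r = 2 * m"
  have nr: "n = 2 * r" using n by (simp add: r_def)
  define h where "h x = sek a n (vcls x) (snd x) w1 w2 * w1 powi fst x
            * (adjQ a (vcls x) b1 b2 * b1 powi fst x * b2 powi snd x)" for x
  have sk: "sek a n \<epsilon> 0 w1 w2 = s0 a \<epsilon> w1 w2" "sek a n \<epsilon> (2 * int n) w1 w2 = s2n a n \<epsilon> w1 w2" for \<epsilon>
    using False by (simp_all add: sek_def)
  have col: "(\<Sum>k\<le>n. h (i, 2 * int k)) = h (i, 0) + h (i, 2 * int n)" for i
  proof -
    have "(\<Sum>k\<le>n. h (i, 2 * int k)) = (\<Sum>k\<in>{0, n}. h (i, 2 * int k))"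
      by (rule sum.mono_neutral_right) (auto simp: h_def sek_def)
    then show ?thesis using False by simp
  qed
  have v: "vcls (2 * int (2 * t) + 1, 0) = 0" "vcls (2 * int (2 * t + 1) + 1, 0) = 1"
    "vcls (2 * int (2 * t) + 1, 2 * int n) = 0" "vcls (2 * int (2 * t + 1) + 1, 2 * int n) = 1" for t
    using vcls_parity(5,6)[of t 0] vcls_parity(5,6)[of t r] by (simp_all add: nr)
  have b2n: "b2 powi (2 * int n) = b2 ^ (2 * n)" "b2 powi (2 * int n - 1) = b2 ^ (2 * n) * inverse b2"
    using nz power_int_of_nat[of b2 "2 * n"] by (simp_all add: power_int_diff divide_inverse)
  define c where "c = (s0 a 0 w1 w2 * adjQ a 0 b1 b2 + s2n a n 0 w1 w2 * adjQ a 0 b1 b2 * b2 ^ (2 * n)) * (w1 * b1)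
    + (s0 a 1 w1 w2 * adjQ a 1 b1 b2 + s2n a n 1 w1 w2 * adjQ a 1 b1 b2 * b2 ^ (2 * n)) * (w1 * b1) ^ 3"
  have "(\<Sum>x\<in>Wv n. h x) = (\<Sum>t<r. c * (w1 ^ 4 * b1 ^ 4) ^ t)"
    unfolding sum_Wv col unfolding nr sum_lessThan_double unfolding nr[symmetric]
  proof (rule sum.cong[OF refl])
    fix t
    show "h (2 * int (2 * t) + 1, 0) + h (2 * int (2 * t) + 1, 2 * int n)
       + (h (2 * int (2 * t + 1) + 1, 0) + h (2 * int (2 * t + 1) + 1, 2 * int n)) = c * (w1 ^ 4 * b1 ^ 4) ^ t"
      unfolding h_def fst_conv snd_conv v sk powi_parity b2n c_def power_mult_distrib power_int_0_right
      by (simp add: algebra_simps)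
  qed
  also have "\<dots> = c * fk r (w1 ^ 4 * b1 ^ 4)" by (simp add: fk_def sum_distrib_left)
  also have "c = dsides a n w1 w2 b1 b2"
  proof -
    obtain p q A I Z S0 S1 T0 T1 :: complex where e: "inverse b1 = p" "inverse b2 = q" "complex_of_real a = A" "\<i> = I"
      "b2 ^ (2 * n) = Z" "s0 a 0 w1 w2 = S0" "s0 a 1 w1 w2 = S1" "s2n a n 0 w1 w2 = T0" "s2n a n 1 w1 w2 = T1" by blast
    have wi: "b1 * p = 1" "b2 * q = 1" "I * I = -1" using nz e by auto
    have "b2 ^ (2 * n + 1) = Z * b2" using e by simp
    note e' = e this b2n(2)[unfolded e]
    show ?thesis
      unfolding c_def dsides_def Let_def adjQ_expand e'
      using wi by algebra
  qed
  finally show ?thesis by (simp add: h_def nr)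
qed

section \<open>The generating function\<close>

text \<open>Every vertex lies in exactly one class, so summing over the classes counts each vertex
  of the bottom and the top row once.\<close>

lemma sum_Weps:
  fixes h :: "nat \<Rightarrow> int \<Rightarrow> int \<Rightarrow> complex"
  shows "(\<Sum>\<epsilon>\<in>{0::nat, 1}. \<Sum>k\<in>{0, 2 * int n}. \<Sum>x1\<in>{x1. (x1, k) \<in> Weps n \<epsilon>}. h \<epsilon> k x1) =
         (\<Sum>x\<in>Wv n. if snd x \<in> {0, 2 * int n} then h (vcls x) (snd x) (fst x) else 0)"
proof -
  have inner: "(\<Sum>x1\<in>{x1. (x1, k) \<in> Weps n \<epsilon>}. h \<epsilon> k x1) =
      (\<Sum>x\<in>Wv n. if vcls x = \<epsilon> then if snd x = k then h (vcls x) (snd x) (fst x) else 0 else 0)"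
    if "\<epsilon> \<in> {0, 1}" for \<epsilon> k
  proof -
    have mem: "x \<in> Weps n \<epsilon> \<longleftrightarrow> x \<in> Wv n \<and> vcls x = \<epsilon>" for x
    proof -
      have "s mod 4 = 1 \<or> s mod 4 = 3" if "odd s" for s :: int using that by presburger
      moreover have "odd (fst x + snd x)" if "x \<in> Wv n" using that by (auto simp: Wv_def)
      ultimately have "(fst x + snd x) mod 4 = 1 \<or> (fst x + snd x) mod 4 = 3" if "x \<in> Wv n" using that by blast
      then show ?thesis using \<open>\<epsilon> \<in> {0, 1}\<close> by (auto simp: Weps_def vcls_def)
    qed
    have "(\<Sum>x1\<in>{x1. (x1, k) \<in> Weps n \<epsilon>}. h \<epsilon> k x1) =
        (\<Sum>x\<in>{x \<in> Wv n. vcls x = \<epsilon> \<and> snd x = k}. h (vcls x) (snd x) (fst x))"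
      unfolding mem by (rule sum.reindex_bij_witness[where i = fst and j = "\<lambda>x1. (x1, k)"]) auto
    also have "\<dots> = (\<Sum>x\<in>Wv n. if vcls x = \<epsilon> \<and> snd x = k then h (vcls x) (snd x) (fst x) else 0)"
      by (rule sum.inter_filter) simp
    finally show ?thesis by (simp only: if_if_eq_conj)
  qed
  have "(\<Sum>\<epsilon>\<in>{0::nat, 1}. \<Sum>k\<in>{0, 2 * int n}. \<Sum>x1\<in>{x1. (x1, k) \<in> Weps n \<epsilon>}. h \<epsilon> k x1) =
      (\<Sum>\<epsilon>\<in>{0::nat, 1}. \<Sum>k\<in>{0, 2 * int n}. \<Sum>x\<in>Wv n.
        if vcls x = \<epsilon> then if snd x = k then h (vcls x) (snd x) (fst x) else 0 else 0)"
    by (intro sum.cong inner refl) 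
  also have "\<dots> = (\<Sum>x\<in>Wv n. \<Sum>\<epsilon>\<in>{0::nat, 1}. \<Sum>k\<in>{0, 2 * int n}.
        if vcls x = \<epsilon> then if snd x = k then h (vcls x) (snd x) (fst x) else 0 else 0)"
    by (subst sum.swap[of _ "Wv n" "{0, 2 * int n}"], rule sum.swap)
  also have "\<dots> = (\<Sum>x\<in>Wv n. if snd x \<in> {0, 2 * int n} then h (vcls x) (snd x) (fst x) else 0)"
  proof (rule sum.cong[OF refl])
    fix x
    have "(\<Sum>\<epsilon>\<in>{0::nat, 1}. \<Sum>k\<in>{0, 2 * int n}.
        if vcls x = \<epsilon> then if snd x = k then h (vcls x) (snd x) (fst x) else 0 else 0) =
        (\<Sum>k\<in>{0, 2 * int n}. if snd x = k then h (vcls x) (snd x) (fst x) else 0)"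
      by (auto simp: vcls_def)
    also have "\<dots> = (if snd x \<in> {0, 2 * int n} then h (vcls x) (snd x) (fst x) else 0)"
      by (rule sum.delta') simp
    finally show "(\<Sum>\<epsilon>\<in>{0::nat, 1}. \<Sum>k\<in>{0, 2 * int n}.
        if vcls x = \<epsilon> then if snd x = k then h (vcls x) (snd x) (fst x) else 0 else 0) =
        (if snd x \<in> {0, 2 * int n} then h (vcls x) (snd x) (fst x) else 0)" .
  qed
  finally show ?thesis .
qed

text \<open>Exchanging the coordinates preserves the class and reduces this to
  \<open>sum_Weps\<close>.\<close>

lemma sum_Beps:
  fixes h :: "nat \<Rightarrow> int \<Rightarrow> int \<Rightarrow> complex"
  shows "(\<Sum>\<epsilon>\<in>{0::nat, 1}. \<Sum>l\<in>{0, 2 * int n}. \<Sum>y2\<in>{y2. (l, y2) \<in> Beps n \<epsilon>}. h \<epsilon> l y2) =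
         (\<Sum>y\<in>Bv n. if fst y \<in> {0, 2 * int n} then h (vcls y) (fst y) (snd y) else 0)"
proof -
  have mem: "(l, y) \<in> Beps n \<epsilon> \<longleftrightarrow> (y, l) \<in> Weps n \<epsilon>" for l y \<epsilon>
    by (simp add: Beps_def Weps_def swap_mem_Bv add.commute)
  have "(\<Sum>\<epsilon>\<in>{0::nat, 1}. \<Sum>l\<in>{0, 2 * int n}. \<Sum>y2\<in>{y2. (l, y2) \<in> Beps n \<epsilon>}. h \<epsilon> l y2) =
      (\<Sum>x\<in>Wv n. if snd x \<in> {0, 2 * int n} then h (vcls x) (snd x) (fst x) else 0)"
    unfolding mem by (rule sum_Weps)
  also have "\<dots> = (\<Sum>y\<in>Bv n. if fst y \<in> {0, 2 * int n} then h (vcls y) (fst y) (snd y) else 0)"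
    by (rule sum.reindex_bij_witness[where i = prod.swap and j = prod.swap])
      (auto simp: swap_mem_Bv vcls_def add.commute)
  finally show ?thesis .
qed

text \<open>The product of \<open>Kast\<close> and \<open>Kinv\<close> is the identity; multiplying
  it from the left by the vector \<open>g\<close> and evaluating with \<open>adjP_Kast\<close>
  leaves only boundary entries of \<open>Kinv\<close>, since \<open>sek\<close> vanishes
  elsewhere.\<close>

lemma Kinv_row_identity:
  assumes a: "a > 0" and y: "y \<in> Bv n" and w: "w1 \<noteq> 0" "w2 \<noteq> 0"
  shows "cdel a w1 w2 * (\<Sum>x\<in>Wv n. Kinv n a 1 x y * w1 powi fst x * w2 powi snd x) =
    adjP a (vcls y) w1 w2 * w1 powi fst y * w2 powi snd y
    - (\<Sum>x\<in>Wv n. sek a n (vcls x) (snd x) w1 w2 * w1 powi fst x * Kinv n a 1 x y)"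
proof -
  define g where "g b = adjP a (vcls b) w1 w2 * w1 powi fst b * w2 powi snd b" for b
  have "g y = (\<Sum>b\<in>Bv n. g b * (if b = y then 1 else 0))"
    using y by (simp add: if_distrib cong: if_cong)
  also have "\<dots> = (\<Sum>b\<in>Bv n. g b * (\<Sum>x\<in>Wv n. Kast n a 1 b x * Kinv n a 1 x y))"
    using Kinv_spec[of a 1 n] a y by (intro sum.cong) auto
  also have "\<dots> = (\<Sum>x\<in>Wv n. (\<Sum>b\<in>Bv n. g b * Kast n a 1 b x) * Kinv n a 1 x y)"
    by (rule sum_mult_assoc_swap)
  also have "\<dots> = (\<Sum>x\<in>Wv n. (cdel a w1 w2 * w1 powi fst x * w2 powi snd x
      + sek a n (vcls x) (snd x) w1 w2 * w1 powi fst x) * Kinv n a 1 x y)"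
  proof (rule sum.cong[OF refl])
    fix x assume "x \<in> Wv n"
    then show "(\<Sum>b\<in>Bv n. g b * Kast n a 1 b x) * Kinv n a 1 x y = (cdel a w1 w2 * w1 powi fst x * w2 powi snd x
      + sek a n (vcls x) (snd x) w1 w2 * w1 powi fst x) * Kinv n a 1 x y"
      using adjP_Kast[of "fst x" "snd x" n w1 w2 a] w by (simp add: g_def)
  qed
  also have "\<dots> = cdel a w1 w2 * (\<Sum>x\<in>Wv n. Kinv n a 1 x y * w1 powi fst x * w2 powi snd x)
      + (\<Sum>x\<in>Wv n. sek a n (vcls x) (snd x) w1 w2 * w1 powi fst x * Kinv n a 1 x y)"
    by (simp only: distrib_right sum.distrib sum_distrib_left) (simp only: mult_ac)
  finally show ?thesis by (simp add: g_def)
qed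

text \<open>The same argument for the product in the other order, multiplied from the right and
  evaluated with \<open>adjQ_Kast\<close>.\<close>

lemma Kinv_column_identity:
  assumes a: "a > 0" and x: "x \<in> Wv n" and b: "b1 \<noteq> 0" "b2 \<noteq> 0"
  shows "cdel a b1 b2 * (\<Sum>y\<in>Bv n. Kinv n a 1 x y * b1 powi fst y * b2 powi snd y) =
    adjQ a (vcls x) b1 b2 * b1 powi fst x * b2 powi snd x
    - (\<Sum>y\<in>Bv n. sek a n (vcls y) (fst y) b2 b1 * b2 powi snd y * Kinv n a 1 x y)"
proof -
  define g where "g w = adjQ a (vcls w) b1 b2 * b1 powi fst w * b2 powi snd w" for w
  have "g x = (\<Sum>w\<in>Wv n. if x = w then g w else 0)"
    using x by simp
  also have "\<dots> = (\<Sum>w\<in>Wv n. (\<Sum>y\<in>Bv n. Kinv n a 1 x y * Kast n a 1 y w) * g w)"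
    using Kinv_spec[of a 1 n] a x by (intro sum.cong) auto
  also have "\<dots> = (\<Sum>y\<in>Bv n. Kinv n a 1 x y * (\<Sum>w\<in>Wv n. Kast n a 1 y w * g w))"
    by (rule sum_mult_assoc_swap[symmetric])
  also have "\<dots> = (\<Sum>y\<in>Bv n. Kinv n a 1 x y * (cdel a b1 b2 * b1 powi fst y * b2 powi snd y
      + sek a n (vcls y) (fst y) b2 b1 * b2 powi snd y))"
  proof (rule sum.cong[OF refl])
    fix y assume "y \<in> Bv n"
    then show "Kinv n a 1 x y * (\<Sum>w\<in>Wv n. Kast n a 1 y w * g w) = Kinv n a 1 x y *
      (cdel a b1 b2 * b1 powi fst y * b2 powi snd y + sek a n (vcls y) (fst y) b2 b1 * b2 powi snd y)"
      using adjQ_Kast[of "fst y" "snd y" n b1 b2 a] b by (simp add: g_def)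
  qed
  finally show ?thesis
    by (simp add: g_def distrib_left sum.distrib sum_distrib_left mult_ac)
qed

text \<open>The relation in \<open>w1\<close>, \<open>w2\<close> yields the diagonal terms and
  leaves entries with \<open>x\<close> on a side; the relation in \<open>b1\<close>,
  \<open>b2\<close> then leaves only those with \<open>y\<close> on a side too. Sums may run over
  all vertices because \<open>sek\<close> is zero off the sides.\<close>

lemma Gf_eq:
  assumes n: "n = 4 * m" and a: "a > 0"
    and nz: "w1 \<noteq> 0" "w2 \<noteq> 0" "b1 \<noteq> 0" "b2 \<noteq> 0" "cdel a w1 w2 \<noteq> 0" "cdel a b1 b2 \<noteq> 0"
  shows "Gf n a w1 w2 b1 b2 = dfun a n w1 w2 b1 b2 / cdel a w1 w2
    + (\<Sum>x\<in>Wv n. \<Sum>y\<in>Bv n. sek a n (vcls x) (snd x) w1 w2 * sek a n (vcls y) (fst y) b2 b1 * Kinv n a 1 x y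
        / (cdel a w1 w2 * cdel a b1 b2) * w1 powi fst x * b2 powi snd y)"
proof -
  define cw cb where "cw = cdel a w1 w2" and "cb = cdel a b1 b2"
  define S where "S x = sek a n (vcls x) (snd x) w1 w2 * w1 powi fst x" for x
  define T where "T y = sek a n (vcls y) (fst y) b2 b1 * b2 powi snd y" for y
  define mb where "mb y = b1 powi fst y * b2 powi snd y" for y
  define Q where "Q x = adjQ a (vcls x) b1 b2 * b1 powi fst x * b2 powi snd x" for x
  have c: "cw \<noteq> 0" "cb \<noteq> 0" using nz by (simp_all add: cw_def cb_def)
  have col: "(\<Sum>y\<in>Bv n. Kinv n a 1 x y * mb y) = (Q x - (\<Sum>y\<in>Bv n. T y * Kinv n a 1 x y)) / cb" if "x \<in> Wv n" for x
    using Kinv_column_identity[OF a that nz(3,4)] c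
    by (simp add: field_simps cb_def Q_def T_def mb_def)
  have "cw * Gf n a w1 w2 b1 b2 =
      (\<Sum>y\<in>Bv n. mb y * (cw * (\<Sum>x\<in>Wv n. Kinv n a 1 x y * w1 powi fst x * w2 powi snd x)))"
    unfolding Gf_def by (subst sum.swap) (simp add: sum_distrib_left mb_def mult_ac)
  also have "\<dots> = (\<Sum>y\<in>Bv n. mb y * (adjP a (vcls y) w1 w2 * w1 powi fst y * w2 powi snd y
      - (\<Sum>x\<in>Wv n. S x * Kinv n a 1 x y)))"
    unfolding cw_def S_def by (intro sum.cong refl) (simp add: Kinv_row_identity[OF a _ nz(1,2)])
  also have "\<dots> = (\<Sum>y\<in>Bv n. adjP a (vcls y) w1 w2 * (w1 * b1) powi fst y * (w2 * b2) powi snd y)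
      - (\<Sum>y\<in>Bv n. mb y * (\<Sum>x\<in>Wv n. Kinv n a 1 x y * S x))"
    by (simp add: right_diff_distrib sum_subtractf mb_def power_int_mult_distrib mult_ac)
  \<comment> \<open>Interchanging the sums exposes, for each \<open>x\<close>, the generating
    function in \<open>b1\<close>, \<open>b2\<close> to which \<open>col\<close> applies.\<close>
  also have "(\<Sum>y\<in>Bv n. mb y * (\<Sum>x\<in>Wv n. Kinv n a 1 x y * S x)) =
      (\<Sum>x\<in>Wv n. S x * (\<Sum>y\<in>Bv n. Kinv n a 1 x y * mb y))"
    by (subst sum_mult_assoc_swap) (simp add: mult_ac)
  also have "\<dots> = (\<Sum>x\<in>Wv n. (S x * Q x - (\<Sum>y\<in>Bv n. S x * T y * Kinv n a 1 x y)) / cb)"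
    by (intro sum.cong refl) (simp only: col times_divide_eq_right right_diff_distrib sum_distrib_left mult.assoc)
  also have "\<dots> = (\<Sum>x\<in>Wv n. S x * Q x) / cb - (\<Sum>x\<in>Wv n. \<Sum>y\<in>Bv n. S x * T y * Kinv n a 1 x y) / cb"
    by (simp add: diff_divide_distrib sum_subtractf flip: sum_divide_distrib)
  also have "(\<Sum>x\<in>Wv n. S x * Q x) = dsides a n w1 w2 b1 b2 * fk (n div 2) (w1 ^ 4 * b1 ^ 4)"
    unfolding S_def Q_def by (rule sum_sek_adjQ[OF n nz(1-4)])
  finally have "cw * Gf n a w1 w2 b1 b2 = dfun a n w1 w2 b1 b2
      + (\<Sum>x\<in>Wv n. \<Sum>y\<in>Bv n. S x * T y * Kinv n a 1 x y) / cb"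
    using sum_adjP_closed[of n "2 * m" w1 w2 b1 b2 a] nz n
    by (simp add: dfun_def Let_def cb_def)
  then have "Gf n a w1 w2 b1 b2 = dfun a n w1 w2 b1 b2 / cw
      + (\<Sum>x\<in>Wv n. \<Sum>y\<in>Bv n. S x * T y * Kinv n a 1 x y) / (cw * cb)"
    using c by (simp add: field_simps)
  then show ?thesis
    by (simp add: sum_divide_distrib S_def T_def cw_def cb_def mult_ac)
qed

theorem theorem4:
  fixes n m :: nat and a :: real
  assumes hn: "n = 4 * m" and ha: "a > 0"
  shows "(\<forall>w1 w2 b1 b2 :: complex.
            w1 \<noteq> 0 \<longrightarrow> w2 \<noteq> 0 \<longrightarrow> b1 \<noteq> 0 \<longrightarrow> b2 \<noteq> 0 \<longrightarrow>
            cdel a w1 w2 \<noteq> 0 \<longrightarrow> cdel a b1 b2 \<noteq> 0 \<longrightarrow>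
            Gf n a w1 w2 b1 b2 =
              dfun a n w1 w2 b1 b2 / cdel a w1 w2
              + (\<Sum>\<epsilon>\<in>{0::nat, 1}. \<Sum>\<delta>\<in>{0::nat, 1}. \<Sum>k\<in>{0, 2 * int n}. \<Sum>l\<in>{0, 2 * int n}.
                  \<Sum>x1\<in>{x1. (x1, k) \<in> Weps n \<epsilon>}. \<Sum>y2\<in>{y2. (l, y2) \<in> Beps n \<delta>}.
                    sek a n \<epsilon> k w1 w2 * sek a n \<delta> l b2 b1 * Kinv n a 1 (x1, k) (l, y2)
                    / (cdel a w1 w2 * cdel a b1 b2) * w1 powi x1 * b2 powi y2))
       \<and> (\<forall>x1 y2 :: int. odd x1 \<longrightarrow> 1 \<le> x1 \<longrightarrow> x1 \<le> 2 * int n - 1 \<longrightarrow>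
                          odd y2 \<longrightarrow> 1 \<le> y2 \<longrightarrow> y2 \<le> 2 * int n - 1 \<longrightarrow>
            Kinv n a 1 (x1, 0) (0, y2) = L n a 1 ((x1 - 1) div 2) ((y2 - 1) div 2)
          \<and> Kinv n a 1 (x1, 0) (2 * int n, y2) =
              \<i> powi (2 * int n - 1 - x1 + y2) * L n 1 a (int n - (x1 + 1) div 2) ((y2 - 1) div 2)
          \<and> Kinv n a 1 (x1, 2 * int n) (0, y2) =
              \<i> powi (2 * int n - 1 + x1 - y2) * L n 1 a ((x1 - 1) div 2) (int n - (y2 + 1) div 2)
          \<and> Kinv n a 1 (x1, 2 * int n) (2 * int n, y2) =
              L n a 1 (int n - (x1 + 1) div 2) (int n - (y2 + 1) div 2))"
proof (intro conjI allI impI)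
  fix w1 w2 b1 b2 :: complex
  assume nz: "w1 \<noteq> 0" "w2 \<noteq> 0" "b1 \<noteq> 0" "b2 \<noteq> 0" "cdel a w1 w2 \<noteq> 0" "cdel a b1 b2 \<noteq> 0"
  define h where "h \<epsilon> \<delta> k l x1 y2 = sek a n \<epsilon> k w1 w2 * sek a n \<delta> l b2 b1 * Kinv n a 1 (x1, k) (l, y2)
                    / (cdel a w1 w2 * cdel a b1 b2) * w1 powi x1 * b2 powi y2" for \<epsilon> \<delta> k l x1 y2
  \<comment> \<open>The sums are reordered so that those belonging to \<open>x\<close> come first
    and those belonging to \<open>y\<close> follow, as \<open>sum_Weps\<close> and
    \<open>sum_Beps\<close> require.\<close>
  have "(\<Sum>\<epsilon>\<in>{0::nat, 1}. \<Sum>\<delta>\<in>{0::nat, 1}. \<Sum>k\<in>{0, 2 * int n}. \<Sum>l\<in>{0, 2 * int n}.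
      \<Sum>x1\<in>{x1. (x1, k) \<in> Weps n \<epsilon>}. \<Sum>y2\<in>{y2. (l, y2) \<in> Beps n \<delta>}. h \<epsilon> \<delta> k l x1 y2) =
    (\<Sum>\<epsilon>\<in>{0::nat, 1}. \<Sum>k\<in>{0, 2 * int n}. \<Sum>x1\<in>{x1. (x1, k) \<in> Weps n \<epsilon>}.
      \<Sum>\<delta>\<in>{0::nat, 1}. \<Sum>l\<in>{0, 2 * int n}. \<Sum>y2\<in>{y2. (l, y2) \<in> Beps n \<delta>}. h \<epsilon> \<delta> k l x1 y2)"
  proof (rule sum.cong[OF refl])
    fix \<epsilon> :: nat
    have 1: "(\<Sum>l\<in>{0, 2 * int n}. \<Sum>x1\<in>{x1. (x1, k) \<in> Weps n \<epsilon>}. \<Sum>y2\<in>{y2. (l, y2) \<in> Beps n \<delta>}. h \<epsilon> \<delta> k l x1 y2)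
      = (\<Sum>x1\<in>{x1. (x1, k) \<in> Weps n \<epsilon>}. \<Sum>l\<in>{0, 2 * int n}. \<Sum>y2\<in>{y2. (l, y2) \<in> Beps n \<delta>}. h \<epsilon> \<delta> k l x1 y2)" for k \<delta>
      by (rule sum.swap)
    show "(\<Sum>\<delta>\<in>{0::nat, 1}. \<Sum>k\<in>{0, 2 * int n}. \<Sum>l\<in>{0, 2 * int n}.
      \<Sum>x1\<in>{x1. (x1, k) \<in> Weps n \<epsilon>}. \<Sum>y2\<in>{y2. (l, y2) \<in> Beps n \<delta>}. h \<epsilon> \<delta> k l x1 y2) =
      (\<Sum>k\<in>{0, 2 * int n}. \<Sum>x1\<in>{x1. (x1, k) \<in> Weps n \<epsilon>}.
      \<Sum>\<delta>\<in>{0::nat, 1}. \<Sum>l\<in>{0, 2 * int n}. \<Sum>y2\<in>{y2. (l, y2) \<in> Beps n \<delta>}. h \<epsilon> \<delta> k l x1 y2)"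
      unfolding 1 by (subst sum.swap) (intro sum.cong refl, rule sum.swap)
  qed
  also have "\<dots> = (\<Sum>x\<in>Wv n. \<Sum>y\<in>Bv n. h (vcls x) (vcls y) (snd x) (fst y) (fst x) (snd y))"
    unfolding sum_Beps sum_Weps by (intro sum.cong refl) (auto simp: h_def sek_def intro!: sum.neutral sum.cong)
  finally show "Gf n a w1 w2 b1 b2 =
              dfun a n w1 w2 b1 b2 / cdel a w1 w2
              + (\<Sum>\<epsilon>\<in>{0::nat, 1}. \<Sum>\<delta>\<in>{0::nat, 1}. \<Sum>k\<in>{0, 2 * int n}. \<Sum>l\<in>{0, 2 * int n}.
                  \<Sum>x1\<in>{x1. (x1, k) \<in> Weps n \<epsilon>}. \<Sum>y2\<in>{y2. (l, y2) \<in> Beps n \<delta>}.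
                    sek a n \<epsilon> k w1 w2 * sek a n \<delta> l b2 b1 * Kinv n a 1 (x1, k) (l, y2)
                    / (cdel a w1 w2 * cdel a b1 b2) * w1 powi x1 * b2 powi y2)"
    unfolding Gf_eq[OF hn ha nz] h_def by simp
next
  fix x1 y2 :: int
  assume x: "odd x1" "1 \<le> x1" "x1 \<le> 2 * int n - 1" and y: "odd y2" "1 \<le> y2" "y2 \<le> 2 * int n - 1"
  have "even n" using hn by simp
  have idx: "2 * ((x1 - 1) div 2) + 1 = x1" "2 * ((y2 - 1) div 2) + 1 = y2"
    "2 * (int n - (x1 + 1) div 2) + 1 = 2 * int n - x1" "2 * (int n - (y2 + 1) div 2) + 1 = 2 * int n - y2"
    using x y by presburger+
  have W: "(x1, 0) \<in> Wv n" "(x1, 2 * int n) \<in> Wv n" "(2 * int n - x1, 0) \<in> Wv n"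
    and B: "(0, y2) \<in> Bv n" "(2 * int n, y2) \<in> Bv n" "(2 * int n, 2 * int n - y2) \<in> Bv n"
    using x y by (auto simp: Wv_def Bv_def)
  show "Kinv n a 1 (x1, 0) (0, y2) = L n a 1 ((x1 - 1) div 2) ((y2 - 1) div 2)"
    unfolding L_def idx ..
  show "Kinv n a 1 (x1, 0) (2 * int n, y2) =
      \<i> powi (2 * int n - 1 - x1 + y2) * L n 1 a (int n - (x1 + 1) div 2) ((y2 - 1) div 2)"
    unfolding L_def idx using Kinv_reflect[OF \<open>even n\<close> ha _ W(1) B(2), of 1] by (simp add: algebra_simps)
  show "Kinv n a 1 (x1, 2 * int n) (2 * int n, y2) = L n a 1 (int n - (x1 + 1) div 2) (int n - (y2 + 1) div 2)"
    unfolding L_def idx using Kinv_rotate[OF ha _ W(2) B(2), of 1] by simp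
  \<comment> \<open>The half-turn leads to \<open>(2 * int n - x1, 0)\<close> and
    \<open>(2 * int n, 2 * int n - y2)\<close>; the reflection then brings the second point back to
    the side \<open>0\<close> and supplies the power of \<open>\<i>\<close>.\<close>
  show "Kinv n a 1 (x1, 2 * int n) (0, y2) =
      \<i> powi (2 * int n - 1 + x1 - y2) * L n 1 a ((x1 - 1) div 2) (int n - (y2 + 1) div 2)"
    unfolding L_def idx
    using Kinv_rotate[OF ha _ W(2) B(1), of 1] Kinv_reflect[OF \<open>even n\<close> ha _ W(3) B(3), of 1]
    by (simp add: algebra_simps)
qed

end
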